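(* Let $G_1$ and $G_2$ be finite non-trivial groups, and let $G=G_1*_H G_2$ be an amalgamated free product of them. Then the space of traces of $G$ is not a Poulsen simplex.
   Context: Given a group $H$ and homomorphisms $f_1:H\to G_1$, $f_2:H\to G_2$, the amalgamated product $G_1*_H G_2$ is the quotient of the free product $G_1*G_2$ by the normal subgroup generated by the elements $f_1(h)f_2(h)^{-1}$, $h\in H$. A trace on a (discrete) group $G$ is a function $\varphi:G\to\mathbb{C}$ which is positive definite, conjugation invariant, and normalized so that $\varphi(e)=1$. The space of traces of $G$ is the compact convex set of all traces with the topology of pointwise convergence. A metrizable Choquet simplex with dense set of extreme points is called a Poulsen simplex; here a single point is not counted as a Poulsen simplex (the Poulsen simplex is infinite, with set of extreme points homeomorphic to an infinite-dimensional separable Banach space). *)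

theory Defs
  imports
    "HOL-Probability.Probability"
    "HOL-Algebra.Coset"
    "HOL-Library.Function_Algebras"
begin

section \<open>Free and amalgamated products of groups\<close>

definition free_product_words ::
    "('a, 'm) monoid_scheme \<Rightarrow> ('b, 'n) monoid_scheme \<Rightarrow> ('a + 'b) list set" where
  "free_product_words G\<^sub>1 G\<^sub>2 = lists (carrier G\<^sub>1 <+> carrier G\<^sub>2)"

text \<open>The congruence on words whose classes are the elements of the free product: adjacent letters
  from the same factor may be multiplied, and the unit of either factor may be deleted.\<close>

inductive_set free_product_rel ::
    "('a, 'm) monoid_scheme \<Rightarrow> ('b, 'n) monoid_scheme \<Rightarrow> (('a + 'b) list \<times> ('a + 'b) list) set"
  for G\<^sub>1 :: "('a, 'm) monoid_scheme" and G\<^sub>2 :: "('b, 'n) monoid_scheme"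
where
  refl: "u \<in> free_product_words G\<^sub>1 G\<^sub>2 \<Longrightarrow> (u, u) \<in> free_product_rel G\<^sub>1 G\<^sub>2"
| sym: "(u, v) \<in> free_product_rel G\<^sub>1 G\<^sub>2 \<Longrightarrow> (v, u) \<in> free_product_rel G\<^sub>1 G\<^sub>2"
| trans: "\<lbrakk>(u, v) \<in> free_product_rel G\<^sub>1 G\<^sub>2; (v, w) \<in> free_product_rel G\<^sub>1 G\<^sub>2\<rbrakk>
    \<Longrightarrow> (u, w) \<in> free_product_rel G\<^sub>1 G\<^sub>2"
| mult1: "\<lbrakk>u \<in> free_product_words G\<^sub>1 G\<^sub>2; v \<in> free_product_words G\<^sub>1 G\<^sub>2;
      x \<in> carrier G\<^sub>1; y \<in> carrier G\<^sub>1\<rbrakk>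
    \<Longrightarrow> (u @ [Inl x, Inl y] @ v, u @ [Inl (x \<otimes>\<^bsub>G\<^sub>1\<^esub> y)] @ v) \<in> free_product_rel G\<^sub>1 G\<^sub>2"
| mult2: "\<lbrakk>u \<in> free_product_words G\<^sub>1 G\<^sub>2; v \<in> free_product_words G\<^sub>1 G\<^sub>2;
      x \<in> carrier G\<^sub>2; y \<in> carrier G\<^sub>2\<rbrakk>
    \<Longrightarrow> (u @ [Inr x, Inr y] @ v, u @ [Inr (x \<otimes>\<^bsub>G\<^sub>2\<^esub> y)] @ v) \<in> free_product_rel G\<^sub>1 G\<^sub>2"
| one1: "\<lbrakk>u \<in> free_product_words G\<^sub>1 G\<^sub>2; v \<in> free_product_words G\<^sub>1 G\<^sub>2\<rbrakk>
    \<Longrightarrow> (u @ [Inl \<one>\<^bsub>G\<^sub>1\<^esub>] @ v, u @ v) \<in> free_product_rel G\<^sub>1 G\<^sub>2"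
| one2: "\<lbrakk>u \<in> free_product_words G\<^sub>1 G\<^sub>2; v \<in> free_product_words G\<^sub>1 G\<^sub>2\<rbrakk>
    \<Longrightarrow> (u @ [Inr \<one>\<^bsub>G\<^sub>2\<^esub>] @ v, u @ v) \<in> free_product_rel G\<^sub>1 G\<^sub>2"

definition free_product ::
    "('a, 'm) monoid_scheme \<Rightarrow> ('b, 'n) monoid_scheme \<Rightarrow> ('a + 'b) list set monoid" where
  "free_product G\<^sub>1 G\<^sub>2 =
    \<lparr>carrier = free_product_words G\<^sub>1 G\<^sub>2 // free_product_rel G\<^sub>1 G\<^sub>2,
     mult = (\<lambda>X Y. \<Union>u\<in>X. \<Union>v\<in>Y. free_product_rel G\<^sub>1 G\<^sub>2 `` {u @ v}),
     one = free_product_rel G\<^sub>1 G\<^sub>2 `` {[]}\<rparr>"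

definition free_product_inl ::
    "('a, 'm) monoid_scheme \<Rightarrow> ('b, 'n) monoid_scheme \<Rightarrow> 'a \<Rightarrow> ('a + 'b) list set" where
  "free_product_inl G\<^sub>1 G\<^sub>2 x = free_product_rel G\<^sub>1 G\<^sub>2 `` {[Inl x]}"

definition free_product_inr ::
    "('a, 'm) monoid_scheme \<Rightarrow> ('b, 'n) monoid_scheme \<Rightarrow> 'b \<Rightarrow> ('a + 'b) list set" where
  "free_product_inr G\<^sub>1 G\<^sub>2 y = free_product_rel G\<^sub>1 G\<^sub>2 `` {[Inr y]}"

text \<open>The hull is the intersection of all normal subgroups containing the given elements.\<close>

definition amalgamated_product ::
    "('h, 'k) monoid_scheme \<Rightarrow> ('a, 'm) monoid_scheme \<Rightarrow> ('b, 'n) monoid_scheme \<Rightarrow>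
      ('h \<Rightarrow> 'a) \<Rightarrow> ('h \<Rightarrow> 'b) \<Rightarrow> ('a + 'b) list set set monoid" where
  "amalgamated_product H G\<^sub>1 G\<^sub>2 f\<^sub>1 f\<^sub>2 =
    free_product G\<^sub>1 G\<^sub>2 Mod
      ((\<lambda>N. N \<lhd> free_product G\<^sub>1 G\<^sub>2) hull
        {free_product_inl G\<^sub>1 G\<^sub>2 (f\<^sub>1 h) \<otimes>\<^bsub>free_product G\<^sub>1 G\<^sub>2\<^esub>
           inv\<^bsub>free_product G\<^sub>1 G\<^sub>2\<^esub> (free_product_inr G\<^sub>1 G\<^sub>2 (f\<^sub>2 h)) | h. h \<in> carrier H})"

section \<open>Traces\<close>

definition positive_definite :: "('g, 'm) monoid_scheme \<Rightarrow> ('g \<Rightarrow> complex) \<Rightarrow> bool" where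
  "positive_definite G \<phi> \<longleftrightarrow>
    (\<forall>(n::nat) (g :: nat \<Rightarrow> 'g) (c :: nat \<Rightarrow> complex). (\<forall>i<n. g i \<in> carrier G) \<longrightarrow>
      (\<Sum>i<n. \<Sum>j<n. cnj (c i) * c j * \<phi> (inv\<^bsub>G\<^esub> g i \<otimes>\<^bsub>G\<^esub> g j)) \<in> \<real>\<^sub>\<ge>\<^sub>0)"

text \<open>A function on the group is represented by its extension by zero outside the carrier, which
  identifies the functions on the carrier with a closed linear subspace of \<^typ>\<open>'g \<Rightarrow> complex\<close>.\<close>

definition is_trace :: "('g, 'm) monoid_scheme \<Rightarrow> ('g \<Rightarrow> complex) \<Rightarrow> bool" where
  "is_trace G \<phi> \<longleftrightarrow>
    positive_definite G \<phi> \<and>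
    (\<forall>g\<in>carrier G. \<forall>h\<in>carrier G. \<phi> (h \<otimes>\<^bsub>G\<^esub> g \<otimes>\<^bsub>G\<^esub> inv\<^bsub>G\<^esub> h) = \<phi> g) \<and>
    \<phi> \<one>\<^bsub>G\<^esub> = 1 \<and>
    (\<forall>g. g \<notin> carrier G \<longrightarrow> \<phi> g = 0)"

definition trace_space :: "('g, 'm) monoid_scheme \<Rightarrow> ('g \<Rightarrow> complex) set" where
  "trace_space G = {\<phi>. is_trace G \<phi>}"


section \<open>Choquet and Poulsen simplices\<close>

text \<open>The topology on a function type is the product topology, that is, pointwise convergence; with
  the pointwise operations, \<^typ>\<open>'i \<Rightarrow> complex\<close> is a Hausdorff locally convex space.\<close>

instantiation "fun" :: (type, real_vector) real_vector
begin

definition scaleR_fun :: "real \<Rightarrow> ('a \<Rightarrow> 'b) \<Rightarrow> 'a \<Rightarrow> 'b" where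
  "scaleR_fun r f = (\<lambda>x. r *\<^sub>R f x)"

instance
  by standard (simp_all add: scaleR_fun_def fun_eq_iff scaleR_add_left scaleR_add_right)

end

definition barycenter :: "('i \<Rightarrow> complex) measure \<Rightarrow> ('i \<Rightarrow> complex) \<Rightarrow> bool" where
  "barycenter \<mu> x \<longleftrightarrow>
    (\<forall>l :: ('i \<Rightarrow> complex) \<Rightarrow> real. linear l \<and> continuous_on UNIV l \<longrightarrow> l x = (\<integral>v. l v \<partial>\<mu>))"

text \<open>In a metrizable compact convex set the extreme points form a Borel set (a countable
  intersection of open sets), so that "supported on the extreme points" means that this set has
  measure one.\<close>

definition metrizable_choquet_simplex :: "('i \<Rightarrow> complex) set \<Rightarrow> bool" where
  "metrizable_choquet_simplex K \<longleftrightarrow>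
    K \<noteq> {} \<and> compact K \<and> convex K \<and> metrizable_space (top_of_set K) \<and>
    (\<forall>x\<in>K. \<exists>!\<mu>. prob_space \<mu> \<and> sets \<mu> = sets (restrict_space borel K) \<and>
      emeasure \<mu> {e. e extreme_point_of K} = 1 \<and> barycenter \<mu> x)"

definition poulsen_simplex :: "('i \<Rightarrow> complex) set \<Rightarrow> bool" where
  "poulsen_simplex K \<longleftrightarrow>
    metrizable_choquet_simplex K \<and> K \<subseteq> closure {e. e extreme_point_of K} \<and> \<not> is_singleton K"

end

theory Submission
  imports Defs "HOL-Algebra.Generated_Groups"
begin

text \<open>
  The trivial trace, which is constantly one, is isolated among the extreme traces of every group that
  is generated by two finite subgroups \<open>A\<close> and \<open>B\<close> (\<open>extreme_trace_trivial\<close>), and the amalgamated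
  product is generated by the images of its two factors (\<open>amalgamated_product_generated\<close>). In a
  convex set with at least two points, an isolated extreme point excludes density of the
  extreme points: the points of a segment that starts there are eventually inside the isolating
  neighbourhood, and no extreme point is near them (\<open>trace_space_not_poulsen\<close>).

  The trivial trace is isolated for the following reason. Let \<open>p\<close> and \<open>q\<close> be the averages over \<open>A\<close> and
  over \<open>B\<close>, which are projections in the group algebra. The trivial trace takes the value one at both
  of them, and all traces \<open>\<phi>\<close> close to it satisfy \<open>\<phi> p + \<phi> q > 1\<close>. In the tracial von Neumann algebra of
  such a \<open>\<phi>\<close> the meet \<open>p \<and> q\<close> has trace at least \<open>\<phi> p + \<phi> q - 1\<close>, which is positive. Its range consists of
  vectors that are fixed by \<open>A\<close> and by \<open>B\<close>, hence by the whole group; so \<open>p \<and> q\<close> is a central projection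
  that splits a positive multiple of the trivial trace off \<open>\<phi>\<close>. If \<open>\<phi>\<close> is extreme, nothing else remains.

  The proof below does not construct the von Neumann algebra. It works in the group algebra with
  the possibly degenerate inner product given by \<open>\<phi>\<close>, and replaces the vector that represents \<open>p \<and> q\<close> by a
  sequence of polynomials in \<open>p\<close> and \<open>q\<close> that is asymptotically fixed by both (\<open>almost_fixed_vectors\<close>).
  Pairing with this sequence shows that \<open>\<phi>\<close> minus a positive multiple of the trivial trace is still
  positive definite (\<open>trace_dominates_trivial\<close>).
\<close>

section \<open>Semi-inner products and pairs of projections\<close>

text \<open>Vectors live in a subspace of an ambient real vector space and the form may be degenerate: the
  vectors will be elements of a group algebra, and the kernel of the form given by a trace is never
  divided out.\<close>

locale semi_inner =
  fixes V :: "'v::real_vector set" and ip :: "'v \<Rightarrow> 'v \<Rightarrow> real"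
  assumes V_subspace: "subspace V"
    and ip_commute: "u \<in> V \<Longrightarrow> v \<in> V \<Longrightarrow> ip u v = ip v u"
    and ip_add_left: "u \<in> V \<Longrightarrow> v \<in> V \<Longrightarrow> w \<in> V \<Longrightarrow> ip (u + v) w = ip u w + ip v w"
    and ip_scale_left: "u \<in> V \<Longrightarrow> w \<in> V \<Longrightarrow> ip (r *\<^sub>R u) w = r * ip u w"
    and ip_nonneg: "u \<in> V \<Longrightarrow> 0 \<le> ip u u"
begin

lemma V_closed [simp]:
  "0 \<in> V"
  "u \<in> V \<Longrightarrow> v \<in> V \<Longrightarrow> u + v \<in> V"
  "u \<in> V \<Longrightarrow> v \<in> V \<Longrightarrow> u - v \<in> V"
  "u \<in> V \<Longrightarrow> r *\<^sub>R u \<in> V"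
  "u \<in> V \<Longrightarrow> - u \<in> V"
  "(\<And>i. i \<in> I \<Longrightarrow> f i \<in> V) \<Longrightarrow> sum f I \<in> V"
  using V_subspace
  by (auto intro: subspace_0 subspace_add subspace_diff subspace_scale subspace_neg subspace_sum)

lemma ip_add_right: "u \<in> V \<Longrightarrow> v \<in> V \<Longrightarrow> w \<in> V \<Longrightarrow> ip w (u + v) = ip w u + ip w v"
  by (simp add: ip_commute [of w] ip_add_left)

lemma ip_scale_right: "u \<in> V \<Longrightarrow> w \<in> V \<Longrightarrow> ip w (r *\<^sub>R u) = r * ip w u"
  by (simp add: ip_commute [of w] ip_scale_left)

lemma ip_zero_left: "w \<in> V \<Longrightarrow> ip 0 w = 0"
  using ip_scale_left [of 0 w 0] by simp

lemma ip_minus_left: "u \<in> V \<Longrightarrow> w \<in> V \<Longrightarrow> ip (- u) w = - ip u w"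
  using ip_scale_left [of u w "-1"] by simp

lemma ip_diff_left: "u \<in> V \<Longrightarrow> v \<in> V \<Longrightarrow> w \<in> V \<Longrightarrow> ip (u - v) w = ip u w - ip v w"
  using ip_add_left [of u "- v" w] by (simp add: ip_minus_left)

lemma ip_diff_right: "u \<in> V \<Longrightarrow> v \<in> V \<Longrightarrow> w \<in> V \<Longrightarrow> ip w (u - v) = ip w u - ip w v"
  by (simp add: ip_commute [of w] ip_diff_left)

lemma ip_sum_left:
  "(\<And>i. i \<in> I \<Longrightarrow> f i \<in> V) \<Longrightarrow> w \<in> V \<Longrightarrow> ip (sum f I) w = (\<Sum>i\<in>I. ip (f i) w)"
  by (induction I rule: infinite_finite_induct) (auto simp: ip_zero_left ip_add_left)

lemma ip_sum_right:
  "(\<And>i. i \<in> I \<Longrightarrow> f i \<in> V) \<Longrightarrow> w \<in> V \<Longrightarrow> ip w (sum f I) = (\<Sum>i\<in>I. ip w (f i))"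
  by (simp add: ip_commute [of w] ip_sum_left)

definition nrm :: "'v \<Rightarrow> real" where
  "nrm v = sqrt (ip v v)"

lemma nrm_nonneg [simp]: "v \<in> V \<Longrightarrow> 0 \<le> nrm v"
  by (simp add: nrm_def ip_nonneg)

lemma nrm_sq: "v \<in> V \<Longrightarrow> (nrm v)\<^sup>2 = ip v v"
  by (simp add: nrm_def ip_nonneg)

lemma nrm_scale: "v \<in> V \<Longrightarrow> nrm (r *\<^sub>R v) = \<bar>r\<bar> * nrm v"
  by (simp add: nrm_def ip_scale_left ip_scale_right real_sqrt_mult flip: mult.assoc)

lemma Cauchy_Schwarz_sq:
  assumes "u \<in> V" "v \<in> V"
  shows "(ip u v)\<^sup>2 \<le> ip u u * ip v v"
proof -
  have quad: "0 \<le> ip u u + 2 * t * ip u v + t\<^sup>2 * ip v v" for t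
    using ip_nonneg [of "u + t *\<^sub>R v"] assms
    by (simp add: ip_add_left ip_add_right ip_scale_left ip_scale_right
        ip_commute [of v u] power2_eq_square algebra_simps)
  show ?thesis
  proof (cases "ip v v = 0")
    case True
    have "ip u v = 0"
    proof (rule ccontr)
      assume ne: "ip u v \<noteq> 0"
      show False
        using quad [of "- (ip u u + 1) / (2 * ip u v)"] True ne ip_nonneg [OF assms(1)]
        by (simp add: field_simps)
    qed
    then show ?thesis using True by simp
  next
    case False
    then have pos: "ip v v > 0" using ip_nonneg [OF assms(2)] by simp
    have "0 \<le> ip u u - (ip u v)\<^sup>2 / ip v v"
      using quad [of "- ip u v / ip v v"] pos by (simp add: power2_eq_square field_simps)
    then show ?thesis using pos by (simp add: field_simps)
  qed
qed

lemma Cauchy_Schwarz: "u \<in> V \<Longrightarrow> v \<in> V \<Longrightarrow> \<bar>ip u v\<bar> \<le> nrm u * nrm v"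
  using real_sqrt_le_mono [OF Cauchy_Schwarz_sq [of u v]] by (simp add: nrm_def real_sqrt_mult)

lemma nrm_triangle:
  assumes "u \<in> V" "v \<in> V"
  shows "nrm (u + v) \<le> nrm u + nrm v"
proof (rule power2_le_imp_le)
  show "(nrm (u + v))\<^sup>2 \<le> (nrm u + nrm v)\<^sup>2"
    using assms Cauchy_Schwarz [of u v]
    by (simp add: nrm_sq power2_sum ip_add_left ip_add_right ip_commute [of v u])
qed (use assms in simp)

lemma nrm_triangle_diff: "u \<in> V \<Longrightarrow> v \<in> V \<Longrightarrow> nrm (u - v) \<le> nrm u + nrm v"
  using nrm_triangle [of u "(-1) *\<^sub>R v"] nrm_scale [of v "-1"] by simp

text \<open>Over a degenerate form an operator with an adjoint need not be linear, since additivity could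
  fail by vectors of norm zero; so linearity is part of the notion.\<close>

definition self_adjoint :: "('v \<Rightarrow> 'v) \<Rightarrow> bool" where
  "self_adjoint f \<longleftrightarrow> f \<in> V \<rightarrow> V \<and>
     (\<forall>u\<in>V. \<forall>v\<in>V. f (u + v) = f u + f v) \<and> (\<forall>r. \<forall>v\<in>V. f (r *\<^sub>R v) = r *\<^sub>R f v) \<and>
     (\<forall>u\<in>V. \<forall>v\<in>V. ip (f u) v = ip u (f v))"

lemma self_adjointD:
  assumes "self_adjoint f"
  shows "v \<in> V \<Longrightarrow> f v \<in> V"
    and "u \<in> V \<Longrightarrow> v \<in> V \<Longrightarrow> f (u + v) = f u + f v"
    and "u \<in> V \<Longrightarrow> v \<in> V \<Longrightarrow> f (u - v) = f u - f v"
    and "v \<in> V \<Longrightarrow> f (r *\<^sub>R v) = r *\<^sub>R f v"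
    and "v \<in> V \<Longrightarrow> f (- v) = - f v"
    and "u \<in> V \<Longrightarrow> v \<in> V \<Longrightarrow> ip (f u) v = ip u (f v)"
proof -
  have sc: "f (r *\<^sub>R v) = r *\<^sub>R f v" if "v \<in> V" for r v
    using assms that by (auto simp: self_adjoint_def)
  have add: "f (u + v) = f u + f v" if "u \<in> V" "v \<in> V" for u v
    using assms that by (auto simp: self_adjoint_def)
  have neg: "f (- v) = - f v" if "v \<in> V" for v
    using sc [OF that, of "-1"] by simp
  show "v \<in> V \<Longrightarrow> f v \<in> V" "u \<in> V \<Longrightarrow> v \<in> V \<Longrightarrow> f (u + v) = f u + f v"
      "v \<in> V \<Longrightarrow> f (r *\<^sub>R v) = r *\<^sub>R f v" "v \<in> V \<Longrightarrow> f (- v) = - f v"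
      "u \<in> V \<Longrightarrow> v \<in> V \<Longrightarrow> ip (f u) v = ip u (f v)"
    using assms sc add neg by (auto simp: self_adjoint_def)
  show "u \<in> V \<Longrightarrow> v \<in> V \<Longrightarrow> f (u - v) = f u - f v"
    using add [of u "- v"] neg [of v] by simp
qed

text \<open>For two projections in a tracial von Neumann algebra, the meet of \<open>P\<close> and \<open>Q\<close> has trace at least
  \<open>\<tau> P + \<tau> Q - 1\<close>. This is a version of that fact, weaker by a factor of two, in a space that
  need not be complete: in the completion, the vectors \<open>v m\<close> converge to
  \<open>2 (P \<and> Q) \<xi>\<close>. The trace property enters through \<open>P'\<close> and \<open>Q'\<close>, the right multiplications
  by \<open>P\<close> and \<open>Q\<close>, which commute with the left multiplications and agree with them on \<open>\<xi>\<close>.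

  Put \<open>x = P + Q - 1\<close> and \<open>d = P - Q\<close>. Then \<open>x d = - d x\<close> and \<open>x\<^sup>2 + d\<^sup>2 = 1\<close>, so \<open>x\<close> is a
  contraction, and where \<open>x\<close> acts as the identity so do \<open>P\<close> and \<open>Q\<close>. The anticommutation and the trace
  property make all odd moments \<open><x ^ n \<xi>, \<xi>>\<close> equal to the first, while the even ones are
  nonnegative; hence \<open>v m = x ^ (2 m) (1 + x) \<xi>\<close> has inner product at least \<open><x \<xi>, \<xi>>\<close> with \<open>\<xi>\<close>.
  Finally \<open>|x ^ n \<xi>|\<close> decreases, and the squared norm drops by \<open>|d x ^ n \<xi>|\<^sup>2\<close> in each step, so that
  \<open>d v m\<close> and \<open>v m - x v m = d\<^sup>2 x ^ (2 m) \<xi>\<close> tend to zero.\<close>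

lemma almost_fixed_vectors:
  assumes P: "self_adjoint P" "\<And>v. v \<in> V \<Longrightarrow> P (P v) = P v"
    and Q: "self_adjoint Q" "\<And>v. v \<in> V \<Longrightarrow> Q (Q v) = Q v"
    and P': "self_adjoint P'" "P' \<xi> = P \<xi>" and Q': "self_adjoint Q'" "Q' \<xi> = Q \<xi>"
    and comm: "\<And>v. v \<in> V \<Longrightarrow> P' (P v) = P (P' v)" "\<And>v. v \<in> V \<Longrightarrow> P' (Q v) = Q (P' v)"
      "\<And>v. v \<in> V \<Longrightarrow> Q' (P v) = P (Q' v)" "\<And>v. v \<in> V \<Longrightarrow> Q' (Q v) = Q (Q' v)"
    and \<xi>: "\<xi> \<in> V"
  obtains v :: "nat \<Rightarrow> 'v" where
    "\<And>m. v m \<in> V"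
    "\<And>m. nrm (v m) \<le> 2 * nrm \<xi>"
    "\<And>m. ip (P \<xi>) \<xi> + ip (Q \<xi>) \<xi> - ip \<xi> \<xi> \<le> ip (v m) \<xi>"
    "(\<lambda>m. nrm (v m - P (v m))) \<longlonglongrightarrow> 0"
    "(\<lambda>m. nrm (v m - Q (v m))) \<longlonglongrightarrow> 0"
proof -
  note PD = self_adjointD [OF P(1)] and QD = self_adjointD [OF Q(1)]
    and P'D = self_adjointD [OF P'(1)] and Q'D = self_adjointD [OF Q'(1)]
  define x where "x = (\<lambda>v. P v + Q v - v)"
  define d where "d = (\<lambda>v. P v - Q v)"
  define d' where "d' = (\<lambda>v. P' v - Q' v)"
  have x: "self_adjoint x"
    by (auto simp: self_adjoint_def x_def PD QD scaleR_add_right scaleR_diff_right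
        ip_add_left ip_add_right ip_diff_left ip_diff_right)
  have d: "self_adjoint d"
    by (auto simp: self_adjoint_def d_def PD QD scaleR_add_right scaleR_diff_right
        ip_add_left ip_add_right ip_diff_left ip_diff_right)
  have d': "self_adjoint d'"
    by (auto simp: self_adjoint_def d'_def P'D Q'D scaleR_add_right scaleR_diff_right
        ip_add_left ip_add_right ip_diff_left ip_diff_right)
  note xD = self_adjointD [OF x] and dD = self_adjointD [OF d] and d'D = self_adjointD [OF d']
  have anti: "x (d v) = - d (x v)" if "v \<in> V" for v
    using that by (simp add: x_def d_def PD QD P(2) Q(2))
  have pyth: "x (x v) + d (d v) = v" if "v \<in> V" for v
    using that by (simp add: x_def d_def PD QD P(2) Q(2))
  have comm_x: "d' (x v) = x (d' v)" and comm_d: "d' (d v) = d (d' v)" if "v \<in> V" for v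
    using that by (simp_all add: x_def d_def d'_def PD QD P'D Q'D comm)
  have d'\<xi>: "d' \<xi> = d \<xi>"
    by (simp add: d_def d'_def P' Q')
  define y where "y = (\<lambda>n. (x ^^ n) \<xi>)"
  have y0: "y 0 = \<xi>" and yS: "y (Suc n) = x (y n)" for n
    by (simp_all add: y_def)
  have yV [simp]: "y n \<in> V" for n
    by (induction n) (simp_all add: y0 yS \<xi> xD)
  define s where "s = (\<lambda>n. ip (y n) \<xi>)"
  have ip_y: "ip (y m) (y n) = s (m + n)" for m n
  proof (induction n arbitrary: m)
    case 0
    then show ?case by (simp add: s_def y0)
  next
    case (Suc n)
    then show ?case
      using Suc [of "Suc m"] by (simp add: yS xD(6))
  qed
  have split: "ip v v = ip (x v) (x v) + ip (d v) (d v)" if "v \<in> V" for v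
  proof -
    have "ip v v = ip (x (x v) + d (d v)) v"
      using that by (simp add: pyth)
    also have "\<dots> = ip (x v) (x v) + ip (d v) (d v)"
      using that by (simp add: ip_add_left xD(1,6) dD(1,6))
    finally show ?thesis .
  qed
  have x_contr: "nrm (x v) \<le> nrm v" and d_contr: "nrm (d v) \<le> nrm v" if "v \<in> V" for v
    using split [OF that] ip_nonneg [of "x v"] ip_nonneg [of "d v"] that
    by (auto simp: nrm_def xD dD)
  have y_bound: "nrm (y n) \<le> nrm \<xi>" for n
    by (induction n) (auto simp: y0 yS intro: order_trans [OF x_contr])
  \<comment> \<open>The difference of the moments is the trace of \<open>x ^ n d d\<close>. Moving the last \<open>d\<close> to the front by
      the trace property and back through the odd power of \<open>x\<close> changes its sign.\<close>
  have s_step: "s (n + 2) = s n" if "odd n" for n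
  proof -
    have swap: "(x ^^ k) (d v) = (-1) ^ k *\<^sub>R d ((x ^^ k) v)" if "v \<in> V" for k v
    proof -
      have xk: "(x ^^ k) v \<in> V" for k
        using that by (induction k) (auto simp: xD)
      show ?thesis
        by (induction k) (simp_all add: xD dD xk anti)
    qed
    have comm_xk: "d' ((x ^^ k) \<xi>) = (x ^^ k) (d' \<xi>)" for k
    proof (induction k)
      case (Suc k)
      then show ?case
        using yV [of k] by (simp add: comm_x y_def)
    qed simp
    have "- ip (d (y n)) (d \<xi>) = ip ((x ^^ n) (d \<xi>)) (d \<xi>)"
      using that by (simp add: swap \<xi> ip_minus_left dD y_def [symmetric, THEN fun_cong])
    also have "\<dots> = ip (d' (y n)) (d' \<xi>)"
      by (simp add: comm_xk d'\<xi> y_def)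
    also have "\<dots> = ip (y n) (d (d \<xi>))"
      using d'D(6) [of "y n" "d' \<xi>"] comm_d [OF \<xi>] by (simp add: d'\<xi> d'D dD \<xi>)
    also have "\<dots> = ip (d (y n)) (d \<xi>)"
      by (simp add: dD \<xi>)
    finally have "ip (d (d (y n))) \<xi> = 0"
      by (simp add: dD(1,6) \<xi>)
    moreover have "s n = ip (x (x (y n)) + d (d (y n))) \<xi>"
      by (simp add: s_def pyth)
    ultimately show ?thesis
      by (simp add: ip_add_left xD dD \<xi> s_def yS)
  qed
  have s_odd: "s (2 * m + 1) = s 1" for m
  proof (induction m)
    case (Suc m)
    then show ?case using s_step [of "2 * m + 1"] by simp
  qed simp
  have s_even: "0 \<le> s (2 * m)" for m
    using ip_nonneg [of "y m"] by (simp add: ip_y mult_2)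
  have dy_lim: "(\<lambda>n. nrm (d (y n))) \<longlonglongrightarrow> 0"
  proof -
    have "decseq (\<lambda>n. ip (y n) (y n))"
    proof (rule decseq_SucI)
      show "ip (y (Suc n)) (y (Suc n)) \<le> ip (y n) (y n)" for n
        using split [of "y n"] ip_nonneg [of "d (y n)"] by (simp add: yS dD(1))
    qed
    moreover have "\<forall>n. 0 \<le> ip (y n) (y n)"
      by (simp add: ip_nonneg)
    ultimately obtain l where l: "(\<lambda>n. ip (y n) (y n)) \<longlonglongrightarrow> l"
      using decseq_convergent by metis
    have "(\<lambda>n. ip (y n) (y n) - ip (y (Suc n)) (y (Suc n))) \<longlonglongrightarrow> l - l"
      using l LIMSEQ_Suc [OF l] by (intro tendsto_diff)
    then have "(\<lambda>n. ip (d (y n)) (d (y n))) \<longlonglongrightarrow> 0"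
      by (simp add: yS split)
    then show ?thesis
      unfolding nrm_def using tendsto_real_sqrt by fastforce
  qed
  define v where "v = (\<lambda>m. y (2 * m) + y (2 * m + 1))"
  have vV [simp]: "v m \<in> V" for m
    by (simp add: v_def)
  have xv: "v m - x (v m) = d (d (y (2 * m)))" for m
    using pyth [of "y (2 * m)"] by (simp add: v_def xD yS algebra_simps)
  have P_v: "v m - P (v m) = (1/2) *\<^sub>R ((v m - x (v m)) - d (v m))"
    and Q_v: "v m - Q (v m) = (1/2) *\<^sub>R ((v m - x (v m)) + d (v m))" for m
    by (simp_all add: x_def d_def algebra_simps flip: scaleR_2)
  have bound: "nrm (v m - P (v m)) \<le> nrm (d (y (2 * m))) + nrm (d (y (2 * m + 1)))"
    "nrm (v m - Q (v m)) \<le> nrm (d (y (2 * m))) + nrm (d (y (2 * m + 1)))" for m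
  proof -
    have 1: "nrm (v m - x (v m)) \<le> nrm (d (y (2 * m)))"
      by (simp add: xv d_contr dD)
    have 2: "nrm (d (v m)) \<le> nrm (d (y (2 * m))) + nrm (d (y (2 * m + 1)))"
      unfolding v_def by (subst dD(2)) (simp_all add: nrm_triangle dD)
    have 3: "v m - x (v m) \<in> V" "d (v m) \<in> V"
      by (simp_all add: xD dD)
    have 4: "nrm (d (y (2 * m + 1))) \<ge> 0"
      by (simp add: dD)
    show "nrm (v m - P (v m)) \<le> nrm (d (y (2 * m))) + nrm (d (y (2 * m + 1)))"
      unfolding P_v using nrm_triangle_diff [OF 3] 1 2 3 4 by (simp add: nrm_scale)
    show "nrm (v m - Q (v m)) \<le> nrm (d (y (2 * m))) + nrm (d (y (2 * m + 1)))"
      unfolding Q_v using nrm_triangle [OF 3] 1 2 3 4 by (simp add: nrm_scale)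
  qed
  have even_odd: "(\<lambda>m. nrm (d (y (2 * m))) + nrm (d (y (2 * m + 1)))) \<longlonglongrightarrow> 0"
  proof -
    have "(\<lambda>m. nrm (d (y (2 * m)))) \<longlonglongrightarrow> 0" "(\<lambda>m. nrm (d (y (2 * m + 1)))) \<longlonglongrightarrow> 0"
      using LIMSEQ_subseq_LIMSEQ [OF dy_lim, of "\<lambda>m. 2 * m"]
        LIMSEQ_subseq_LIMSEQ [OF dy_lim, of "\<lambda>m. 2 * m + 1"]
      by (simp_all add: strict_mono_def o_def)
    then show ?thesis
      using tendsto_add by fastforce
  qed
  show thesis
  proof (rule that [of v])
    show "v m \<in> V" for m by simp
    show "nrm (v m) \<le> 2 * nrm \<xi>" for m
      using nrm_triangle [of "y (2 * m)" "y (2 * m + 1)"] y_bound [of "2 * m"]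
        y_bound [of "2 * m + 1"] by (simp add: v_def)
    have "s 1 = ip (P \<xi>) \<xi> + ip (Q \<xi>) \<xi> - ip \<xi> \<xi>"
      by (simp add: s_def yS y0 x_def ip_add_left ip_diff_left PD QD \<xi>)
    then show "ip (P \<xi>) \<xi> + ip (Q \<xi>) \<xi> - ip \<xi> \<xi> \<le> ip (v m) \<xi>" for m
      using s_odd [of m] s_even [of m] by (simp add: v_def ip_add_left \<xi> s_def)
    show "(\<lambda>m. nrm (v m - P (v m))) \<longlonglongrightarrow> 0"
      by (rule tendsto_sandwich [OF _ always_eventually [OF allI [OF bound(1)]]
            tendsto_const even_odd]) (simp add: PD)
    show "(\<lambda>m. nrm (v m - Q (v m))) \<longlonglongrightarrow> 0"
      by (rule tendsto_sandwich [OF _ always_eventually [OF allI [OF bound(2)]]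
            tendsto_const even_odd]) (simp add: QD)
  qed
qed

end

section \<open>Averages over finite subgroups\<close>

text \<open>The action is indexed by a group so that one definition of averages serves both the left and
  the right translations of the group algebra.\<close>

locale orthogonal_action = semi_inner V ip + group G
  for V :: "'v::real_vector set" and ip and G :: "('g, 'm) monoid_scheme" (structure) +
  fixes U :: "'g \<Rightarrow> 'v \<Rightarrow> 'v"
  assumes U_closed [simp]: "g \<in> carrier G \<Longrightarrow> v \<in> V \<Longrightarrow> U g v \<in> V"
    and U_add: "g \<in> carrier G \<Longrightarrow> u \<in> V \<Longrightarrow> v \<in> V \<Longrightarrow> U g (u + v) = U g u + U g v"
    and U_scale: "g \<in> carrier G \<Longrightarrow> v \<in> V \<Longrightarrow> U g (r *\<^sub>R v) = r *\<^sub>R U g v"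
    and U_one: "v \<in> V \<Longrightarrow> U \<one> v = v"
    and U_mult: "g \<in> carrier G \<Longrightarrow> h \<in> carrier G \<Longrightarrow> v \<in> V \<Longrightarrow> U (g \<otimes> h) v = U g (U h v)"
    and U_isometry: "g \<in> carrier G \<Longrightarrow> u \<in> V \<Longrightarrow> v \<in> V \<Longrightarrow> ip (U g u) (U g v) = ip u v"
begin

lemma U_diff: "g \<in> carrier G \<Longrightarrow> u \<in> V \<Longrightarrow> v \<in> V \<Longrightarrow> U g (u - v) = U g u - U g v"
  using U_add [of g u "(-1) *\<^sub>R v"] U_scale [of g v "-1"] by simp

lemma U_sum:
  "g \<in> carrier G \<Longrightarrow> (\<And>i. i \<in> I \<Longrightarrow> f i \<in> V) \<Longrightarrow> U g (sum f I) = (\<Sum>i\<in>I. U g (f i))"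
  using U_scale [of g 0 0] by (induction I rule: infinite_finite_induct) (auto simp: U_add)

lemma U_adjoint:
  assumes "g \<in> carrier G" "u \<in> V" "v \<in> V"
  shows "ip (U g u) v = ip u (U (inv g) v)"
proof -
  have "U g (U (inv g) v) = v"
    using assms by (simp add: U_one flip: U_mult)
  then show ?thesis
    using U_isometry [of g u "U (inv g) v"] assms by simp
qed

lemma nrm_U: "g \<in> carrier G \<Longrightarrow> v \<in> V \<Longrightarrow> nrm (U g v) = nrm v"
  by (simp add: nrm_def U_isometry)

definition average :: "'g set \<Rightarrow> 'v \<Rightarrow> 'v" where
  "average A v = (1 / card A) *\<^sub>R (\<Sum>a\<in>A. U a v)"

context
  fixes A assumes A: "subgroup A G" "finite A"
begin

lemma mem_subgroup [simp]: "a \<in> A \<Longrightarrow> a \<in> carrier G"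
  using A by (simp add: subgroup.mem_carrier)

lemma card_subgroup_pos: "card A > 0"
  using A subgroup.one_closed card_gt_0_iff by blast

lemma average_closed: "v \<in> V \<Longrightarrow> average A v \<in> V"
  by (simp add: average_def)

lemma U_average:
  assumes "a \<in> A" "v \<in> V"
  shows "U a (average A v) = average A v"
proof -
  have "U a (\<Sum>b\<in>A. U b v) = (\<Sum>b\<in>A. U (a \<otimes> b) v)"
    using assms by (simp add: U_sum U_mult)
  also have "\<dots> = (\<Sum>b\<in>A. U b v)"
    using A(1) assms(1)
    by (intro sum.reindex_bij_witness [where i = "\<lambda>b. inv a \<otimes> b" and j = "\<lambda>b. a \<otimes> b"])
      (auto simp: subgroup.m_closed subgroup.m_inv_closed simp flip: m_assoc)
  finally show ?thesis
    using assms by (simp add: average_def U_scale)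
qed

lemma average_fixed: "v \<in> V \<Longrightarrow> (\<And>a. a \<in> A \<Longrightarrow> U a v = v) \<Longrightarrow> average A v = v"
  using card_subgroup_pos by (simp add: average_def scaleR_sum_left [symmetric] sum_constant_scaleR)

lemma average_idem: "v \<in> V \<Longrightarrow> average A (average A v) = average A v"
  by (rule average_fixed) (simp_all add: average_closed U_average)

lemma average_self_adjoint: "self_adjoint (average A)"
  unfolding self_adjoint_def
proof (intro conjI ballI allI)
  show "average A \<in> V \<rightarrow> V"
    by (simp add: average_closed)
  show "average A (u + v) = average A u + average A v" if "u \<in> V" "v \<in> V" for u v
    using that by (simp add: average_def U_add sum.distrib scaleR_add_right)
  show "average A (r *\<^sub>R v) = r *\<^sub>R average A v" if "v \<in> V" for r v
    using that by (simp add: average_def U_scale scaleR_sum_right mult.commute)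
  show "ip (average A u) v = ip u (average A v)" if "u \<in> V" "v \<in> V" for u v
  proof -
    have "ip (\<Sum>a\<in>A. U a u) v = (\<Sum>a\<in>A. ip u (U (inv a) v))"
      using that by (simp add: ip_sum_left U_adjoint)
    also have "\<dots> = (\<Sum>a\<in>A. ip u (U a v))"
      using A(1) by (intro sum.reindex_bij_witness [where i = "\<lambda>a. inv a" and j = "\<lambda>a. inv a"])
        (auto simp: subgroup.m_inv_closed)
    finally show ?thesis
      using that by (simp add: average_def ip_scale_left ip_scale_right ip_sum_right)
  qed
qed

end

text \<open>An average over a subgroup absorbs its translations, so vectors that are nearly fixed by the
  average are nearly fixed by each element of the subgroup. Being nearly fixed passes to products,
  because the group acts by isometries.\<close>

lemma almost_invariant:
  assumes AB: "subgroup A G" "finite A" "subgroup B G" "finite B"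
    and v: "\<And>m. v m \<in> V"
      "(\<lambda>m. nrm (v m - average A (v m))) \<longlonglongrightarrow> 0" "(\<lambda>m. nrm (v m - average B (v m))) \<longlonglongrightarrow> 0"
    and g: "g \<in> generate G (A \<union> B)"
  shows "(\<lambda>m. nrm (U g (v m) - v m)) \<longlonglongrightarrow> 0"
proof -
  have one_group: "(\<lambda>m. nrm (U a (v m) - v m)) \<longlonglongrightarrow> 0"
    if C: "subgroup C G" "finite C" "(\<lambda>m. nrm (v m - average C (v m))) \<longlonglongrightarrow> 0" and a: "a \<in> C" for C a
  proof (rule tendsto_sandwich [OF _ _ tendsto_const])
    have aG: "a \<in> carrier G"
      using C(1) a by (rule subgroup.mem_carrier)
    show "\<forall>\<^sub>F m in sequentially. 0 \<le> nrm (U a (v m) - v m)"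
      using aG by (simp add: v(1))
    have "nrm (U a (v m) - v m) \<le> 2 * nrm (v m - average C (v m))" for m
    proof -
      define w where "w = v m - average C (v m)"
      have w: "w \<in> V"
        by (simp add: w_def v(1) average_closed [OF C(1,2)])
      have "U a (v m) - v m = U a w - w"
        by (simp add: w_def U_diff aG v(1) average_closed [OF C(1,2)] U_average [OF C(1,2) a])
      then show ?thesis
        using nrm_triangle_diff [of "U a w" w] aG w by (simp add: nrm_U flip: w_def)
    qed
    then show "\<forall>\<^sub>F m in sequentially. nrm (U a (v m) - v m) \<le> 2 * nrm (v m - average C (v m))"
      by simp
    show "(\<lambda>m. 2 * nrm (v m - average C (v m))) \<longlonglongrightarrow> 0"
      using tendsto_mult_left [OF C(3), of 2] by simp
  qed
  have gens: "(\<lambda>m. nrm (U h (v m) - v m)) \<longlonglongrightarrow> 0" if "h \<in> A \<union> B" for h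
    using one_group [OF AB(1,2) v(2)] one_group [OF AB(3,4) v(3)] that by blast
  have sub: "A \<union> B \<subseteq> carrier G"
    using AB subgroup.subset by blast
  show ?thesis
    using g
  proof (induction g rule: generate.induct)
    case one
    then show ?case
      using v(1) by (simp add: U_one nrm_def ip_zero_left)
  next
    case (inv h)
    then have "inv h \<in> A \<union> B"
      using AB by (auto simp: subgroup.m_inv_closed)
    then show ?case
      by (rule gens)
  next
    case (eng h1 h2)
    then have h: "h1 \<in> carrier G" "h2 \<in> carrier G"
      using generate_in_carrier [OF sub] by auto
    have "nrm (U (h1 \<otimes> h2) (v m) - v m) \<le> nrm (U h2 (v m) - v m) + nrm (U h1 (v m) - v m)" for m
      using nrm_triangle [of "U h1 (U h2 (v m) - v m)" "U h1 (v m) - v m"] h v(1)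
      by (simp add: nrm_U) (simp add: U_diff U_mult)
    then have upper: "\<forall>\<^sub>F m in sequentially. nrm (U (h1 \<otimes> h2) (v m) - v m)
        \<le> nrm (U h2 (v m) - v m) + nrm (U h1 (v m) - v m)"
      by simp
    have lim: "(\<lambda>m. nrm (U h2 (v m) - v m) + nrm (U h1 (v m) - v m)) \<longlonglongrightarrow> 0"
      using tendsto_add [OF eng.IH(2,1)] by simp
    have lower: "\<forall>\<^sub>F m in sequentially. 0 \<le> nrm (U (h1 \<otimes> h2) (v m) - v m)"
      using h v(1) by simp
    show ?case
      by (rule tendsto_sandwich [OF lower upper tendsto_const lim])
  qed (rule gens)
qed

end

section \<open>The group algebra with the inner product of a trace\<close>

text \<open>A formal linear combination of group elements is represented by the functional that sends \<open>f\<close> to the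
  same linear combination of the values of \<open>f\<close>. Unlike finitely supported coefficient functions,
  functionals can be translated and paired with a trace without reference to their support.\<close>

definition group_algebra :: "('g, 'm) monoid_scheme \<Rightarrow> (('g \<Rightarrow> complex) \<Rightarrow> complex) set" where
  "group_algebra G = span {\<lambda>f. c * f x | c x. x \<in> carrier G}"

definition left_translate ::
    "('g, 'm) monoid_scheme \<Rightarrow> 'g \<Rightarrow> (('g \<Rightarrow> complex) \<Rightarrow> complex) \<Rightarrow> ('g \<Rightarrow> complex) \<Rightarrow> complex" where
  "left_translate G g T = (\<lambda>f. T (\<lambda>y. f (g \<otimes>\<^bsub>G\<^esub> y)))"

text \<open>The inverse turns right multiplication into a left action.\<close>

definition right_translate ::
    "('g, 'm) monoid_scheme \<Rightarrow> 'g \<Rightarrow> (('g \<Rightarrow> complex) \<Rightarrow> complex) \<Rightarrow> ('g \<Rightarrow> complex) \<Rightarrow> complex" where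
  "right_translate G g T = (\<lambda>f. T (\<lambda>y. f (y \<otimes>\<^bsub>G\<^esub> inv\<^bsub>G\<^esub> g)))"

text \<open>The real part of the inner product of the representation that \<open>\<phi>\<close> defines, that is, of
  \<open>\<phi> (S\<^sup>* T)\<close>: on the elements \<open>x\<close> and \<open>y\<close> of the group, the form is \<open>Re (\<phi> (inv x \<otimes> y))\<close>. The functionals
  \<open>S\<close> and \<open>T\<close> are linear, and the conjugation under \<open>S\<close>, under the real part, has the effect of
  conjugating the coefficients of \<open>S\<close>.\<close>

definition trace_form ::
    "('g, 'm) monoid_scheme \<Rightarrow> ('g \<Rightarrow> complex) \<Rightarrow>
      (('g \<Rightarrow> complex) \<Rightarrow> complex) \<Rightarrow> (('g \<Rightarrow> complex) \<Rightarrow> complex) \<Rightarrow> real" where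
  "trace_form G \<phi> S T = Re (S (\<lambda>x. cnj (T (\<lambda>y. \<phi> (inv\<^bsub>G\<^esub> x \<otimes>\<^bsub>G\<^esub> y)))))"

lemma sum_fun_eq: "sum F I = (\<lambda>x. \<Sum>i\<in>I. F i x)"
  by (induction I rule: infinite_finite_induct) (auto simp: fun_eq_iff)

lemma group_algebra_point: "x \<in> carrier G \<Longrightarrow> (\<lambda>f. c * f x) \<in> group_algebra G"
  unfolding group_algebra_def by (rule span_base) auto

lemma group_algebra_combination:
  assumes "\<And>i. i < n \<Longrightarrow> g i \<in> carrier G"
  shows "(\<lambda>f. \<Sum>i<(n::nat). c i * f (g i)) \<in> group_algebra G"
proof -
  have "(\<Sum>i<n. (\<lambda>f. c i * f (g i))) \<in> group_algebra G"
    using assms group_algebra_point unfolding group_algebra_def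
    by (intro span_sum) (fastforce simp: group_algebra_def)
  then show ?thesis
    by (simp add: sum_fun_eq)
qed

lemma group_algebra_cases:
  assumes "T \<in> group_algebra G"
  obtains n :: nat and g c where "\<forall>i<n. g i \<in> carrier G" "T = (\<lambda>f. \<Sum>i<n. c i * f (g i))"
proof -
  have "\<exists>(n::nat) g c. (\<forall>i<n. g i \<in> carrier G) \<and> T = (\<lambda>f. \<Sum>i<n. c i * f (g i))"
    using assms unfolding group_algebra_def
  proof (induction rule: span_induct_alt)
    case base
    show ?case
      by (rule exI [of _ 0]) (auto simp: zero_fun_def)
  next
    case (step r S T)
    then obtain n g c where T: "\<forall>i<(n::nat). g i \<in> carrier G" "T = (\<lambda>f. \<Sum>i<n. c i * f (g i))"
      by blast
    from step obtain a x where S: "S = (\<lambda>f. a * f x)" "x \<in> carrier G"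
      by blast
    have "r *\<^sub>R S + T = (\<lambda>f. \<Sum>i<Suc n. (c(n := r *\<^sub>R a)) i * f ((g(n := x)) i))"
      by (simp add: S T fun_eq_iff scaleR_fun_def)
    moreover have "\<forall>i<Suc n. (g(n := x)) i \<in> carrier G"
      using T S by (simp add: less_Suc_eq)
    ultimately show ?case by blast
  qed
  then show thesis using that by blast
qed

lemma group_algebra_cong:
  assumes "T \<in> group_algebra G" "\<And>x. x \<in> carrier G \<Longrightarrow> f x = f' x"
  shows "T f = T f'"
  using assms(1) by (rule group_algebra_cases) (simp add: assms(2))

locale trace_group = group G for G :: "('g, 'm) monoid_scheme" (structure) +
  fixes \<phi> :: "'g \<Rightarrow> complex"
  assumes trace: "is_trace G \<phi>"
begin

lemma trace_positive:
  "(\<And>i. i < n \<Longrightarrow> g i \<in> carrier G) \<Longrightarrow>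
    (\<Sum>i<(n::nat). \<Sum>j<n. cnj (c i) * c j * \<phi> (inv (g i) \<otimes> g j)) \<in> \<real>\<^sub>\<ge>\<^sub>0"
  using trace by (simp add: is_trace_def positive_definite_def)

lemma trace_conj: "g \<in> carrier G \<Longrightarrow> h \<in> carrier G \<Longrightarrow> \<phi> (h \<otimes> g \<otimes> inv h) = \<phi> g"
  using trace by (simp add: is_trace_def)

lemma trace_one: "\<phi> \<one> = 1"
  using trace by (simp add: is_trace_def)

text \<open>Positivity for the two points \<open>1\<close> and \<open>x\<close>: the coefficients \<open>1, 1\<close> give the imaginary parts, the
  coefficients \<open>1, \<i>\<close> the real parts.\<close>

lemma trace_inv:
  assumes "x \<in> carrier G"
  shows "\<phi> (inv x) = cnj (\<phi> x)"
proof -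
  have nonneg: "cnj a * a + (cnj a * b * \<phi> x + cnj b * a * \<phi> (inv x)) + cnj b * b \<in> \<real>\<^sub>\<ge>\<^sub>0" for a b
    using trace_positive [of 2 "\<lambda>i. if i = 0 then \<one> else x" "\<lambda>i. if i = 0 then a else b"] assms
    by (simp add: numeral_2_eq_2 trace_one add.assoc)
  show ?thesis
    using nonneg [of 1 1] nonneg [of 1 \<i>]
    by (auto simp: complex_eq_iff complex_nonneg_Reals_iff)
qed

lemma trace_form_combination:
  "trace_form G \<phi> (\<lambda>f. \<Sum>i<(n::nat). c i * f (g i)) (\<lambda>f. \<Sum>j<(k::nat). d j * f (h j)) =
    Re (\<Sum>i<n. \<Sum>j<k. cnj (c i) * d j * \<phi> (inv (g i) \<otimes> h j))"
proof -
  have "cnj (\<Sum>i<n. \<Sum>j<k. cnj (c i) * d j * \<phi> (inv (g i) \<otimes> h j)) =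
      (\<Sum>i<n. c i * cnj (\<Sum>j<k. d j * \<phi> (inv (g i) \<otimes> h j)))"
    by (simp add: sum_distrib_left mult.assoc)
  from arg_cong [OF this, of Re] show ?thesis
    unfolding trace_form_def by (simp only: cnj.sel)
qed

sublocale semi_inner "group_algebra G" "trace_form G \<phi>"
proof
  show "subspace (group_algebra G)"
    by (simp add: group_algebra_def)
  show "trace_form G \<phi> S T = trace_form G \<phi> T S" if S: "S \<in> group_algebra G" and T: "T \<in> group_algebra G" for S T
  proof -
    from S obtain n g c where 1: "\<forall>i<(n::nat). g i \<in> carrier G" "S = (\<lambda>f. \<Sum>i<n. c i * f (g i))"
      by (rule group_algebra_cases)
    from T obtain k h d where 2: "\<forall>i<(k::nat). h i \<in> carrier G" "T = (\<lambda>f. \<Sum>i<k. d i * f (h i))"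
      by (rule group_algebra_cases)
    have flip: "\<phi> (inv (h j) \<otimes> g i) = cnj (\<phi> (inv (g i) \<otimes> h j))" if "i < n" "j < k" for i j
      using that trace_inv [of "inv (g i) \<otimes> h j"] 1(1) 2(1) by (simp add: inv_mult_group)
    have "(\<Sum>j<k. \<Sum>i<n. cnj (d j) * c i * \<phi> (inv (h j) \<otimes> g i)) =
        cnj (\<Sum>i<n. \<Sum>j<k. cnj (c i) * d j * \<phi> (inv (g i) \<otimes> h j))"
      by (subst sum.swap) (simp add: flip mult_ac)
    then show ?thesis
      by (simp only: 1(2) 2(2) trace_form_combination cnj.sel)
  qed
  show "0 \<le> trace_form G \<phi> T T" if "T \<in> group_algebra G" for T
  proof -
    from that obtain n g c where "\<forall>i<(n::nat). g i \<in> carrier G" "T = (\<lambda>f. \<Sum>i<n. c i * f (g i))"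
      by (rule group_algebra_cases)
    then show ?thesis
      using trace_positive [of n g c]
      by (simp only: trace_form_combination complex_nonneg_Reals_iff)
  qed
  show "trace_form G \<phi> (S + T) W = trace_form G \<phi> S W + trace_form G \<phi> T W" for S T W
    unfolding trace_form_def plus_fun_def by simp
  show "trace_form G \<phi> (r *\<^sub>R S) W = r * trace_form G \<phi> S W" for r S W
    unfolding trace_form_def scaleR_fun_def by simp
qed

sublocale left: orthogonal_action "group_algebra G" "trace_form G \<phi>" G "left_translate G"
proof
  show "left_translate G x T \<in> group_algebra G" if "x \<in> carrier G" "T \<in> group_algebra G" for x T
    using that(2)
  proof (rule group_algebra_cases)
    fix n :: nat and g c
    assume "\<forall>i<n. g i \<in> carrier G" "T = (\<lambda>f. \<Sum>i<n. c i * f (g i))"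
    then show ?thesis
      using group_algebra_combination [of n "\<lambda>i. x \<otimes> g i" G c] that(1)
      by (simp add: left_translate_def)
  qed
  show "left_translate G \<one> T = T" if "T \<in> group_algebra G" for T
    using that by (auto simp: left_translate_def fun_eq_iff intro: group_algebra_cong)
  show "left_translate G (x \<otimes> y) T = left_translate G x (left_translate G y T)"
    if "x \<in> carrier G" "y \<in> carrier G" "T \<in> group_algebra G" for x y T
    using that by (auto simp: left_translate_def fun_eq_iff m_assoc intro!: group_algebra_cong [OF that(3)])
  show "trace_form G \<phi> (left_translate G x S) (left_translate G x T) = trace_form G \<phi> S T"
    if x: "x \<in> carrier G" and S: "S \<in> group_algebra G" and T: "T \<in> group_algebra G" for x S T
  proof -
    have "inv (x \<otimes> y) \<otimes> (x \<otimes> z) = inv y \<otimes> z" if "y \<in> carrier G" "z \<in> carrier G" for y z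
    proof -
      have "inv (x \<otimes> y) \<otimes> (x \<otimes> z) = inv y \<otimes> (inv x \<otimes> x) \<otimes> z"
        using x that by (simp only: inv_mult_group m_assoc m_closed inv_closed)
      then show ?thesis
        using x that by simp
    qed
    then have "T (\<lambda>z. \<phi> (inv (x \<otimes> y) \<otimes> (x \<otimes> z))) = T (\<lambda>z. \<phi> (inv y \<otimes> z))"
      if "y \<in> carrier G" for y
      using that by (intro group_algebra_cong [OF T]) simp
    then show ?thesis
      unfolding trace_form_def left_translate_def
      by (intro arg_cong [where f = Re] group_algebra_cong [OF S]) simp
  qed
  show "left_translate G x (S + T) = left_translate G x S + left_translate G x T" for x S T
    unfolding left_translate_def plus_fun_def by simp
  show "left_translate G x (r *\<^sub>R T) = r *\<^sub>R left_translate G x T" for x r T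
    unfolding left_translate_def scaleR_fun_def by simp
qed

text \<open>Conjugation invariance of the trace is exactly what makes the right translations isometric.\<close>

sublocale right: orthogonal_action "group_algebra G" "trace_form G \<phi>" G "right_translate G"
proof
  show "right_translate G x T \<in> group_algebra G" if "x \<in> carrier G" "T \<in> group_algebra G" for x T
    using that(2)
  proof (rule group_algebra_cases)
    fix n :: nat and g c
    assume "\<forall>i<n. g i \<in> carrier G" "T = (\<lambda>f. \<Sum>i<n. c i * f (g i))"
    then show ?thesis
      using group_algebra_combination [of n "\<lambda>i. g i \<otimes> inv x" G c] that(1)
      by (simp add: right_translate_def)
  qed
  show "right_translate G \<one> T = T" if "T \<in> group_algebra G" for T
    using that by (auto simp: right_translate_def fun_eq_iff intro: group_algebra_cong)
  show "right_translate G (x \<otimes> y) T = right_translate G x (right_translate G y T)"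
    if "x \<in> carrier G" "y \<in> carrier G" "T \<in> group_algebra G" for x y T
    using that
    by (auto simp: right_translate_def fun_eq_iff m_assoc inv_mult_group intro!: group_algebra_cong [OF that(3)])
  show "trace_form G \<phi> (right_translate G x S) (right_translate G x T) = trace_form G \<phi> S T"
    if x: "x \<in> carrier G" and S: "S \<in> group_algebra G" and T: "T \<in> group_algebra G" for x S T
  proof -
    have "\<phi> (inv (y \<otimes> inv x) \<otimes> (z \<otimes> inv x)) = \<phi> (inv y \<otimes> z)"
      if "y \<in> carrier G" "z \<in> carrier G" for y z
    proof -
      have "inv (y \<otimes> inv x) \<otimes> (z \<otimes> inv x) = x \<otimes> (inv y \<otimes> z) \<otimes> inv x"
        using x that by (simp add: inv_mult_group m_assoc)
      then show ?thesis
        using x that trace_conj by simp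
    qed
    then have "T (\<lambda>z. \<phi> (inv (y \<otimes> inv x) \<otimes> (z \<otimes> inv x))) = T (\<lambda>z. \<phi> (inv y \<otimes> z))"
      if "y \<in> carrier G" for y
      using that by (intro group_algebra_cong [OF T]) simp
    then show ?thesis
      unfolding trace_form_def right_translate_def
      by (intro arg_cong [where f = Re] group_algebra_cong [OF S]) simp
  qed
  show "right_translate G x (S + T) = right_translate G x S + right_translate G x T" for x S T
    unfolding right_translate_def plus_fun_def by simp
  show "right_translate G x (r *\<^sub>R T) = r *\<^sub>R right_translate G x T" for x r T
    unfolding right_translate_def scaleR_fun_def by simp
qed

lemma translates_commute:
  assumes "a \<in> carrier G" "b \<in> carrier G" "T \<in> group_algebra G"
  shows "right_translate G a (left_translate G b T) = left_translate G b (right_translate G a T)"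
  using assms
  by (auto simp: right_translate_def left_translate_def fun_eq_iff m_assoc
      intro!: group_algebra_cong [OF assms(3)])

lemma averages_commute:
  assumes "A \<subseteq> carrier G" "B \<subseteq> carrier G" "T \<in> group_algebra G"
  shows "right.average A (left.average B T) = left.average B (right.average A T)"
proof -
  let ?R = "right_translate G" and ?L = "left_translate G"
  have A: "a \<in> carrier G" if "a \<in> A" for a using that assms(1) by blast
  have B: "b \<in> carrier G" if "b \<in> B" for b using that assms(2) by blast
  have *: "?R a (left.average B T) = (1 / card B) *\<^sub>R (\<Sum>b\<in>B. ?R a (?L b T))" if "a \<in> A" for a
    using A [OF that] B assms(3) unfolding left.average_def
    by (subst right.U_scale) (simp_all add: right.U_sum)
  have "?L b (right.average A T) = (1 / card A) *\<^sub>R (\<Sum>a\<in>A. ?L b (?R a T))" if "b \<in> B" for b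
    using A B [OF that] assms(3) unfolding right.average_def
    by (subst left.U_scale) (simp_all add: left.U_sum)
  then have "left.average B (right.average A T) =
      (1 / card B) *\<^sub>R (1 / card A) *\<^sub>R (\<Sum>b\<in>B. \<Sum>a\<in>A. ?L b (?R a T))"
    unfolding left.average_def by (simp only: scaleR_sum_right cong: sum.cong)
  also have "(\<Sum>b\<in>B. \<Sum>a\<in>A. ?L b (?R a T)) = (\<Sum>a\<in>A. \<Sum>b\<in>B. ?R a (?L b T))"
    by (subst sum.swap, intro sum.cong) (simp_all add: translates_commute A B assms(3))
  also have "(1 / card B) *\<^sub>R (1 / card A) *\<^sub>R \<dots> = right.average A (left.average B T)"
    using * unfolding right.average_def by (simp only: scaleR_left_commute scaleR_sum_right cong: sum.cong)
  finally show ?thesis ..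
qed

end

section \<open>The trivial trace\<close>

definition real_mean :: "'g set \<Rightarrow> ('g \<Rightarrow> complex) \<Rightarrow> real" where
  "real_mean A \<phi> = (\<Sum>a\<in>A. Re (\<phi> a)) / card A"

context trace_group
begin

abbreviation (input) unit_mass :: "('g \<Rightarrow> complex) \<Rightarrow> complex" where
  "unit_mass \<equiv> (\<lambda>f. f \<one>)"

lemma unit_mass_in: "unit_mass \<in> group_algebra G"
  using group_algebra_point [of \<one> G 1] by simp

lemma nrm_unit_mass: "nrm unit_mass = 1"
  by (simp add: nrm_def trace_form_def trace_one)

text \<open>The input that \<open>almost_fixed_vectors\<close> needs about \<open>\<xi> = 1\<close>. The right average is taken with the inverses of
  the elements, but inversion permutes a subgroup.\<close>

lemma average_unit_mass:
  assumes "subgroup A G" "finite A"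
  shows "trace_form G \<phi> (left.average A unit_mass) unit_mass = real_mean A \<phi>"
    and "right.average A unit_mass = left.average A unit_mass"
proof -
  have A: "a \<in> carrier G" if "a \<in> A" for a
    using assms(1) that by (rule subgroup.mem_carrier)
  have "trace_form G \<phi> (left_translate G a unit_mass) unit_mass = Re (\<phi> a)" if "a \<in> A" for a
    using A [OF that] by (simp add: trace_form_def left_translate_def trace_inv)
  then show "trace_form G \<phi> (left.average A unit_mass) unit_mass = real_mean A \<phi>"
    using A by (simp add: left.average_def real_mean_def ip_scale_left ip_sum_left unit_mass_in)
  have "(\<Sum>a\<in>A. right_translate G a unit_mass) = (\<Sum>a\<in>A. left_translate G a unit_mass)"
    using assms(1) A
    by (intro sum.reindex_bij_witness [where i = "\<lambda>a. inv a" and j = "\<lambda>a. inv a"])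
      (auto simp: subgroup.m_inv_closed right_translate_def left_translate_def)
  then show "right.average A unit_mass = left.average A unit_mass"
    by (simp add: left.average_def right.average_def)
qed

text \<open>A positive multiple of the trivial trace is dominated by \<open>\<phi>\<close>: for \<open>a\<close> in the group
  algebra, with sum of coefficients \<open>\<epsilon>\<close>, the nearly invariant vectors \<open>v m\<close> do not distinguish
  \<open>a\<close> from \<open>\<epsilon>\<close> times the unit. Hence \<open><v m, a>\<close> is close to \<open>\<epsilon> <v m, 1>\<close>, where
  \<open><v m, 1>\<close> is at least \<open>\<kappa> = real_mean A \<phi> + real_mean B \<phi> - 1\<close>, and the Cauchy-Schwarz inequality
  with \<open>nrm (v m) \<le> 2\<close> gives \<open>\<kappa> * cmod \<epsilon> \<le> 2 * nrm a\<close>.\<close>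

lemma trace_dominates_trivial:
  fixes n :: nat
  assumes AB: "subgroup A G" "finite A" "subgroup B G" "finite B"
    and gen: "generate G (A \<union> B) = carrier G"
    and pos: "real_mean A \<phi> + real_mean B \<phi> > 1"
    and g: "\<And>i. i < n \<Longrightarrow> g i \<in> carrier G"
  shows "(real_mean A \<phi> + real_mean B \<phi> - 1)\<^sup>2 / 4 * (cmod (\<Sum>i<n. c i))\<^sup>2 \<le>
    Re (\<Sum>i<n. \<Sum>j<n. cnj (c i) * c j * \<phi> (inv (g i) \<otimes> g j))"
proof -
  define \<kappa> where "\<kappa> = real_mean A \<phi> + real_mean B \<phi> - 1"
  define r where "r = cmod (\<Sum>i<n. c i)"
  have \<kappa>: "\<kappa> > 0" and r: "r \<ge> 0"
    using pos by (simp_all add: \<kappa>_def r_def)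
  note sub = subgroup.subset [OF AB(1)] subgroup.subset [OF AB(3)]
  obtain v where v: "\<And>m. v m \<in> group_algebra G" "\<And>m. nrm (v m) \<le> 2 * nrm unit_mass"
    "\<And>m. trace_form G \<phi> (left.average A unit_mass) unit_mass +
        trace_form G \<phi> (left.average B unit_mass) unit_mass - trace_form G \<phi> unit_mass unit_mass
        \<le> trace_form G \<phi> (v m) unit_mass"
    and v_lim: "(\<lambda>m. nrm (v m - left.average A (v m))) \<longlonglongrightarrow> 0"
    "(\<lambda>m. nrm (v m - left.average B (v m))) \<longlonglongrightarrow> 0"
    using almost_fixed_vectors [of "left.average A" "left.average B" "right.average A" unit_mass
        "right.average B"] AB sub
    by (auto simp: left.average_self_adjoint right.average_self_adjoint left.average_idem
        averages_commute average_unit_mass unit_mass_in)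
  have v_bound: "nrm (v m) \<le> 2" and v_large: "\<kappa> \<le> trace_form G \<phi> (v m) unit_mass" for m
    using v(2,3) [of m] nrm_sq [OF unit_mass_in]
    by (simp_all add: nrm_unit_mass average_unit_mass AB \<kappa>_def)
  have inv_lim: "(\<lambda>m. nrm (left_translate G x (v m) - v m)) \<longlonglongrightarrow> 0" if "x \<in> carrier G" for x
    using left.almost_invariant [OF AB v(1) v_lim] that gen by simp
  \<comment> \<open>The form only sees real parts; rotating the coefficients makes their sum real and nonnegative.\<close>
  obtain \<omega> where \<omega>: "cmod \<omega> = 1" "\<omega> * (\<Sum>i<n. c i) = of_real r"
  proof (cases "r = 0")
    case True
    then show thesis using that [of 1] by (simp add: r_def)
  next
    case False
    define z where "z = (\<Sum>i<n. c i)"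
    have "z * cnj z = of_real r * of_real r"
      using complex_norm_square [of z] by (simp add: r_def z_def power2_eq_square)
    then have "cnj z / of_real r * z = of_real r"
      using False by (simp add: mult.commute)
    moreover have "cmod (cnj z / of_real r) = 1"
      using False by (simp add: norm_divide r_def z_def del: cnj_sum)
    ultimately show thesis
      using that by (simp add: z_def)
  qed
  \<comment> \<open>The summand of \<open>T\<close> at \<open>g i\<close> is the translate of \<open>p i\<close>, a multiple of the unit.\<close>
  define p where "p = (\<lambda>i (f :: 'g \<Rightarrow> complex). \<omega> * c i * f \<one>)"
  define T where "T = (\<lambda>f :: 'g \<Rightarrow> complex. \<Sum>i<n. \<omega> * c i * f (g i))"
  have p: "p i \<in> group_algebra G" for i
    unfolding p_def by (rule group_algebra_point) simp
  have T_in: "T \<in> group_algebra G"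
    unfolding T_def using g by (intro group_algebra_combination)
  have T: "T = (\<Sum>i<n. left_translate G (g i) (p i))"
    using g by (simp add: T_def p_def left_translate_def sum_fun_eq fun_eq_iff)
  have p_sum: "(\<Sum>i<n. p i) = r *\<^sub>R unit_mass"
    using \<omega>(2) by (simp add: p_def sum_fun_eq fun_eq_iff scaleR_fun_def scaleR_conv_of_real
        flip: sum_distrib_right sum_distrib_left)
  define e where "e = (\<lambda>m. \<Sum>i<n. nrm (left_translate G (inv (g i)) (v m) - v m) * nrm (p i))"
  have e_lim: "e \<longlonglongrightarrow> 0"
    unfolding e_def using g by (intro tendsto_null_sum tendsto_mult_left_zero inv_lim) simp
  have "r * \<kappa> \<le> 2 * nrm T + e m" for m
  proof -
    have "r * \<kappa> \<le> trace_form G \<phi> (v m) (\<Sum>i<n. p i)"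
      using v_large [of m] r by (simp add: p_sum ip_scale_right unit_mass_in v(1) mult_left_mono)
    also have "\<dots> = (\<Sum>i<n. trace_form G \<phi> (v m) (p i))"
      by (simp add: ip_sum_right p v(1))
    also have "\<dots> = (\<Sum>i<n. trace_form G \<phi> (v m) (left_translate G (g i) (p i)) +
        trace_form G \<phi> (v m - left_translate G (inv (g i)) (v m)) (p i))"
      using g p v(1) by (intro sum.cong) (auto simp: ip_diff_left left.U_adjoint)
    also have "\<dots> \<le> (\<Sum>i<n. trace_form G \<phi> (v m) (left_translate G (g i) (p i)) +
        nrm (left_translate G (inv (g i)) (v m) - v m) * nrm (p i))"
    proof (intro sum_mono add_left_mono)
      fix i assume "i \<in> {..<n}"
      then have w: "left_translate G (inv (g i)) (v m) \<in> group_algebra G"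
        using g v(1) by simp
      then show "trace_form G \<phi> (v m - left_translate G (inv (g i)) (v m)) (p i)
          \<le> nrm (left_translate G (inv (g i)) (v m) - v m) * nrm (p i)"
        using Cauchy_Schwarz [of "left_translate G (inv (g i)) (v m) - v m" "p i"] p v(1)
        by (simp add: ip_diff_left)
    qed
    also have "\<dots> = trace_form G \<phi> (v m) T + e m"
    proof -
      have "trace_form G \<phi> (v m) T = (\<Sum>i<n. trace_form G \<phi> (v m) (left_translate G (g i) (p i)))"
        unfolding T using g p v(1) by (intro ip_sum_right) simp_all
      then show ?thesis
        by (simp add: e_def sum.distrib)
    qed
    also have "trace_form G \<phi> (v m) T \<le> 2 * nrm T"
      using Cauchy_Schwarz [OF v(1) T_in, of m] mult_right_mono [OF v_bound [of m], of "nrm T"] T_in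
      by simp
    finally show ?thesis by simp
  qed
  then have "r * \<kappa> \<le> 2 * nrm T + 0"
    by (intro LIMSEQ_le_const [OF tendsto_add [OF tendsto_const e_lim]]) auto
  then have "(r * \<kappa>)\<^sup>2 \<le> (2 * nrm T)\<^sup>2"
    using r \<kappa> by (intro power_mono) simp_all
  then have "\<kappa>\<^sup>2 / 4 * r\<^sup>2 \<le> trace_form G \<phi> T T"
    by (simp add: power_mult_distrib nrm_sq T_in mult.commute)
  also have "\<dots> = Re (\<Sum>i<n. \<Sum>j<n. cnj (c i) * c j * \<phi> (inv (g i) \<otimes> g j))"
  proof -
    have "cnj (\<omega> * c i) * (\<omega> * c j) = cnj (c i) * c j" for i j
      using \<omega>(1) complex_norm_square [of \<omega>] by (simp add: mult_ac)
    then show ?thesis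
      unfolding T_def trace_form_combination by (simp only:)
  qed
  finally show ?thesis
    by (simp add: \<kappa>_def r_def)
qed

end

definition trivial_trace :: "('g, 'm) monoid_scheme \<Rightarrow> 'g \<Rightarrow> complex" where
  "trivial_trace G = (\<lambda>x. if x \<in> carrier G then 1 else 0)"

lemma (in group) sum_trivial_trace:
  assumes "\<And>i. i < (n::nat) \<Longrightarrow> g i \<in> carrier G"
  shows "(\<Sum>i<n. \<Sum>j<n. cnj (c i) * c j * trivial_trace G (inv (g i) \<otimes> g j)) =
    of_real ((cmod (\<Sum>i<n. c i))\<^sup>2)"
proof -
  have "(\<Sum>i<n. \<Sum>j<n. cnj (c i) * c j * trivial_trace G (inv (g i) \<otimes> g j)) =
      (\<Sum>i<n. \<Sum>j<n. cnj (c i) * c j)"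
    using assms by (simp add: trivial_trace_def)
  also have "\<dots> = (\<Sum>i<n. c i) * cnj (\<Sum>i<n. c i)"
    by (subst mult.commute) (simp add: sum_product)
  also have "\<dots> = of_real ((cmod (\<Sum>i<n. c i))\<^sup>2)"
    by (rule complex_norm_square [symmetric])
  finally show ?thesis .
qed

lemma (in group) trivial_trace: "is_trace G (trivial_trace G)"
proof -
  have "positive_definite G (trivial_trace G)"
    by (simp add: positive_definite_def sum_trivial_trace del: of_real_power)
  then show ?thesis
    by (simp add: is_trace_def trivial_trace_def)
qed

text \<open>By the domination, \<open>\<phi>\<close> is a proper convex combination of the trivial trace and another trace, which
  extremality permits only if \<open>\<phi>\<close> is itself trivial.\<close>

lemma (in group) extreme_trace_trivial:
  assumes AB: "subgroup A G" "finite A" "subgroup B G" "finite B"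
    and gen: "generate G (A \<union> B) = carrier G"
    and pos: "real_mean A \<phi> + real_mean B \<phi> > 1"
    and ext: "\<phi> extreme_point_of trace_space G"
  shows "\<phi> = trivial_trace G"
proof (rule ccontr)
  assume ne: "\<phi> \<noteq> trivial_trace G"
  have \<phi>: "is_trace G \<phi>"
    using ext by (simp add: extreme_point_of_def trace_space_def)
  interpret trace_group G \<phi>
    using \<phi> by unfold_locales
  \<comment> \<open>The cap at one half keeps the complementary weight \<open>1 - l\<close> positive.\<close>
  define l where "l = min ((real_mean A \<phi> + real_mean B \<phi> - 1)\<^sup>2 / 4) (1/2)"
  have l: "0 < l" "l < 1"
    using pos by (simp_all add: l_def)
  define \<psi> where "\<psi> = (1 / (1 - l)) *\<^sub>R (\<phi> - l *\<^sub>R trivial_trace G)"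
  have \<psi>_eq: "\<psi> x = of_real (1 / (1 - l)) * (\<phi> x - of_real l * trivial_trace G x)" for x
    by (simp add: \<psi>_def scaleR_fun_def scaleR_conv_of_real)
  have "is_trace G \<psi>"
    unfolding is_trace_def
  proof (intro conjI ballI allI impI)
    show "positive_definite G \<psi>"
      unfolding positive_definite_def
    proof (intro allI impI)
      fix n :: nat and g c
      assume "\<forall>i<n. g i \<in> carrier G"
      then have g: "\<And>i. i < n \<Longrightarrow> g i \<in> carrier G" by simp
      define S where "S = (\<Sum>i<n. \<Sum>j<n. cnj (c i) * c j * \<phi> (inv (g i) \<otimes> g j))"
      define q where "q = (cmod (\<Sum>i<n. c i))\<^sup>2"
      have "(\<Sum>i<n. \<Sum>j<n. cnj (c i) * c j * \<psi> (inv (g i) \<otimes> g j)) =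
          of_real (1 / (1 - l)) * (S - of_real l *
            (\<Sum>i<n. \<Sum>j<n. cnj (c i) * c j * trivial_trace G (inv (g i) \<otimes> g j)))"
        by (simp only: S_def \<psi>_eq sum_distrib_left right_diff_distrib sum_subtractf mult_ac)
      also have "\<dots> = of_real (1 / (1 - l)) * (S - of_real (l * q))"
        by (simp only: sum_trivial_trace [OF g] q_def of_real_mult)
      also have "S = of_real (Re S)"
      proof -
        have "S \<in> \<real>\<^sub>\<ge>\<^sub>0"
          unfolding S_def using g by (rule trace_positive)
        then show ?thesis
          by (simp add: complex_nonneg_Reals_iff complex_eq_iff)
      qed
      finally have "(\<Sum>i<n. \<Sum>j<n. cnj (c i) * c j * \<psi> (inv (g i) \<otimes> g j)) =
          of_real (1 / (1 - l) * (Re S - l * q))"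
        by simp
      moreover have "l * q \<le> Re S"
      proof -
        have "l * q \<le> (real_mean A \<phi> + real_mean B \<phi> - 1)\<^sup>2 / 4 * q"
          by (intro mult_right_mono) (simp_all add: l_def q_def)
        also have "\<dots> \<le> Re S"
          unfolding q_def S_def by (rule trace_dominates_trivial [OF AB gen pos g])
        finally show ?thesis .
      qed
      ultimately show "(\<Sum>i<n. \<Sum>j<n. cnj (c i) * c j * \<psi> (inv (g i) \<otimes> g j)) \<in> \<real>\<^sub>\<ge>\<^sub>0"
        using l by (simp only: nonneg_Reals_of_real_iff) simp
    qed
    show "\<psi> (h \<otimes> g \<otimes> inv h) = \<psi> g" if "g \<in> carrier G" "h \<in> carrier G" for g h
      using that by (simp add: \<psi>_eq trace_conj trivial_trace_def)
    show "\<psi> \<one> = 1"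
    proof -
      have "\<psi> \<one> = of_real (1 / (1 - l) * (1 - l))"
        by (simp only: \<psi>_eq trace_one trivial_trace_def one_closed if_True of_real_mult of_real_diff
            of_real_1 mult_1_right)
      then show ?thesis
        using l by simp
    qed
    show "\<psi> x = 0" if "x \<notin> carrier G" for x
      using that \<phi> by (simp add: \<psi>_eq trivial_trace_def is_trace_def)
  qed
  moreover have \<phi>_eq: "\<phi> = (1 - (1 - l)) *\<^sub>R trivial_trace G + (1 - l) *\<^sub>R \<psi>"
    using l by (simp add: \<psi>_def)
  moreover have "trivial_trace G \<noteq> \<psi>"
  proof
    assume "trivial_trace G = \<psi>"
    with \<phi>_eq have "\<phi> = (1 - (1 - l) + (1 - l)) *\<^sub>R trivial_trace G"
      by (simp only: scaleR_add_left)
    with ne show False by simp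
  qed
  ultimately have "\<phi> \<in> open_segment (trivial_trace G) \<psi>"
    using l unfolding in_segment by (intro conjI exI [of _ "1 - l"]) auto
  with ext \<open>is_trace G \<psi>\<close> trivial_trace show False
    by (auto simp: extreme_point_of_def trace_space_def)
qed

text \<open>The traces with \<open>real_mean A \<phi> + real_mean B \<phi> > 1\<close> form an open neighbourhood of the trivial trace in
  which no other trace is extreme. Any other trace \<open>\<psi>\<close> gives a segment from the trivial trace
  towards \<open>\<psi>\<close>; the points that are close to the trivial trace, but different from it, lie in this
  neighbourhood and are not limits of extreme traces.\<close>

theorem (in group) trace_space_not_poulsen:
  assumes AB: "subgroup A G" "finite A" "subgroup B G" "finite B"
    and gen: "generate G (A \<union> B) = carrier G"
  shows "\<not> poulsen_simplex (trace_space G)"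
proof
  assume P: "poulsen_simplex (trace_space G)"
  let ?K = "trace_space G" and ?\<chi> = "trivial_trace G"
  have conv: "convex ?K" and dense: "?K \<subseteq> closure {e. e extreme_point_of ?K}"
    and ns: "\<not> is_singleton ?K"
    using P by (simp_all add: poulsen_simplex_def metrizable_choquet_simplex_def)
  have \<chi>: "?\<chi> \<in> ?K"
    using trivial_trace by (simp add: trace_space_def)
  then obtain \<psi> where \<psi>: "\<psi> \<in> ?K" "\<psi> \<noteq> ?\<chi>"
    using ns unfolding is_singleton_def by blast
  define k where "k = (\<lambda>\<phi>. real_mean A \<phi> + real_mean B \<phi> - 1)"
  have card: "card C > 0" if "subgroup C G" "finite C" for C
    using that subgroup.one_closed card_gt_0_iff by blast
  have mean1: "real_mean C ?\<chi> = 1" if "subgroup C G" "finite C" for C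
  proof -
    have "(\<Sum>a\<in>C. Re (?\<chi> a)) = (\<Sum>a\<in>C. 1)"
      using that subgroup.mem_carrier by (intro sum.cong) (fastforce simp: trivial_trace_def)+
    then show ?thesis
      using card [OF that] by (simp add: real_mean_def)
  qed
  have k\<chi>: "k ?\<chi> = 1"
    using AB by (simp add: k_def mean1)
  \<comment> \<open>Small enough for the affine function \<open>k\<close> to stay positive at the point \<open>\<theta>\<close> of the segment.\<close>
  define t where "t = 1 / (2 + \<bar>k \<psi>\<bar>)"
  have t: "0 < t" "t < 1"
    by (simp_all add: t_def)
  define \<theta> where "\<theta> = (1 - t) *\<^sub>R ?\<chi> + t *\<^sub>R \<psi>"
  have \<theta>K: "\<theta> \<in> ?K"
    using conv \<chi> \<psi> t unfolding \<theta>_def by (intro convexD) auto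
  have mean_\<theta>: "real_mean C \<theta> = (1 - t) * real_mean C ?\<chi> + t * real_mean C \<psi>" for C
    by (simp add: real_mean_def \<theta>_def scaleR_fun_def sum.distrib add_divide_distrib
        flip: sum_distrib_left)
  have "k \<theta> = (1 - t) * k ?\<chi> + t * k \<psi>"
    by (simp add: k_def mean_\<theta> algebra_simps)
  moreover have "1 - t * (1 + \<bar>k \<psi>\<bar>) \<le> (1 - t) * k ?\<chi> + t * k \<psi>"
    using mult_left_mono [OF abs_ge_minus_self [of "k \<psi>"], of t] t by (simp add: k\<chi> algebra_simps)
  moreover have "0 < 1 - t * (1 + \<bar>k \<psi>\<bar>)"
    by (simp add: t_def field_simps)
  ultimately have k\<theta>: "k \<theta> > 0" by linarith
  have "\<theta> - ?\<chi> = t *\<^sub>R (\<psi> - ?\<chi>)"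
    by (simp add: \<theta>_def algebra_simps)
  then have "\<theta> \<noteq> ?\<chi>"
    using t \<psi>(2) by auto
  then obtain x where x: "\<theta> x \<noteq> ?\<chi> x" by (auto simp: fun_eq_iff)
  let ?W = "{\<phi>. 0 < k \<phi>} \<inter> {\<phi>. \<phi> x \<noteq> ?\<chi> x}"
  have "open ?W"
    unfolding k_def real_mean_def
    by (intro open_Int open_Collect_less open_Collect_neq continuous_intros)
      (use card [OF AB(1,2)] card [OF AB(3,4)] in auto)
  moreover have "\<theta> \<in> ?W"
    using k\<theta> x by simp
  moreover have "\<theta> \<in> closure {e. e extreme_point_of ?K}"
    using \<theta>K dense by blast
  ultimately have "?W \<inter> {e. e extreme_point_of ?K} \<noteq> {}"
    using open_Int_closure_eq_empty by blast
  then obtain \<phi> where "\<phi> \<in> ?W" "\<phi> extreme_point_of ?K"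
    by blast
  with extreme_trace_trivial [OF AB gen, of \<phi>] show False
    by (auto simp: k_def)
qed

section \<open>The amalgamated product is generated by the images of its factors\<close>

locale two_groups = G1: group G\<^sub>1 + G2: group G\<^sub>2
  for G\<^sub>1 :: "('a, 'm) monoid_scheme" and G\<^sub>2 :: "('b, 'n) monoid_scheme"
begin

abbreviation F where "F \<equiv> free_product G\<^sub>1 G\<^sub>2"
abbreviation words where "words \<equiv> free_product_words G\<^sub>1 G\<^sub>2"
abbreviation rel where "rel \<equiv> free_product_rel G\<^sub>1 G\<^sub>2"
abbreviation cls where "cls u \<equiv> rel `` {u}"

lemma words_simps [simp]:
  "[] \<in> words"
  "u @ v \<in> words \<longleftrightarrow> u \<in> words \<and> v \<in> words"
  "Inl x # u \<in> words \<longleftrightarrow> x \<in> carrier G\<^sub>1 \<and> u \<in> words"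
  "Inr y # u \<in> words \<longleftrightarrow> y \<in> carrier G\<^sub>2 \<and> u \<in> words"
  by (auto simp: free_product_words_def)

lemma rel_in_words: "(u, v) \<in> rel \<Longrightarrow> u \<in> words \<and> v \<in> words"
  by (induction rule: free_product_rel.induct) auto

lemma equiv_rel: "equiv words rel"
proof (rule equivI)
  show "rel \<subseteq> words \<times> words"
    using rel_in_words by auto
  show "refl_on words rel"
    by (auto intro: refl_onI free_product_rel.refl)
  show "sym rel"
    by (rule symI) (rule free_product_rel.sym)
  show "trans rel"
    by (rule transI) (rule free_product_rel.trans)
qed

lemma rel_context:
  assumes "(u, v) \<in> rel" "p \<in> words" "q \<in> words"
  shows "(p @ u @ q, p @ v @ q) \<in> rel"
  using assms(1)
proof (induction rule: free_product_rel.induct)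
  case (mult1 u v x y)
  then show ?case
    using free_product_rel.mult1 [of "p @ u" G\<^sub>1 G\<^sub>2 "v @ q" x y] assms(2,3) by simp
next
  case (mult2 u v x y)
  then show ?case
    using free_product_rel.mult2 [of "p @ u" G\<^sub>1 G\<^sub>2 "v @ q" x y] assms(2,3) by simp
next
  case (one1 u v)
  then show ?case
    using free_product_rel.one1 [of "p @ u" G\<^sub>1 G\<^sub>2 "v @ q"] assms(2,3) by simp
next
  case (one2 u v)
  then show ?case
    using free_product_rel.one2 [of "p @ u" G\<^sub>1 G\<^sub>2 "v @ q"] assms(2,3) by simp
next
  case (refl u)
  then show ?case
    using assms(2,3) by (simp add: free_product_rel.refl)
next
  case (sym u v)
  show ?case
    using sym.IH by (rule free_product_rel.sym)
next
  case (trans u v w)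
  show ?case
    using trans.IH by (rule free_product_rel.trans)
qed

lemma rel_append:
  assumes "(u, u') \<in> rel" "(v, v') \<in> rel"
  shows "(u @ v, u' @ v') \<in> rel"
proof (rule free_product_rel.trans)
  show "(u @ v, u' @ v) \<in> rel"
    using rel_context [OF assms(1), of "[]" v] rel_in_words [OF assms(2)] by simp
  show "(u' @ v, u' @ v') \<in> rel"
    using rel_context [OF assms(2), of u' "[]"] rel_in_words [OF assms(1)] by simp
qed

lemma cls_eq_iff: "u \<in> words \<Longrightarrow> v \<in> words \<Longrightarrow> cls u = cls v \<longleftrightarrow> (u, v) \<in> rel"
  using equiv_rel by (rule eq_equiv_class_iff)

lemma carrier_F: "carrier F = {cls u | u. u \<in> words}"
  by (auto simp: free_product_def quotient_def)

lemma mult_F: "u \<in> words \<Longrightarrow> v \<in> words \<Longrightarrow> cls u \<otimes>\<^bsub>F\<^esub> cls v = cls (u @ v)"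
proof -
  assume u: "u \<in> words" and v: "v \<in> words"
  have const: "cls (u' @ v') = cls (u @ v)" if "u' \<in> cls u" "v' \<in> cls v" for u' v'
  proof -
    have uv: "(u, u') \<in> rel" "(v, v') \<in> rel"
      using that by auto
    then show ?thesis
      using equiv_class_eq [OF equiv_rel rel_append [OF uv]] by simp
  qed
  have "u \<in> cls u" "v \<in> cls v"
    using u v by (simp_all add: free_product_rel.refl)
  then have ne: "cls u \<noteq> {}" "cls v \<noteq> {}"
    by blast+
  have "cls u \<otimes>\<^bsub>F\<^esub> cls v = (\<Union>u'\<in>cls u. \<Union>v'\<in>cls v. cls (u' @ v'))"
    by (simp add: free_product_def)
  also have "\<dots> = (\<Union>u'\<in>cls u. \<Union>v'\<in>cls v. cls (u @ v))"
    by (intro SUP_cong const) simp_all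
  also have "\<dots> = cls (u @ v)"
    using ne by (simp only: UN_constant if_False)
  finally show ?thesis .
qed

lemma one_F: "\<one>\<^bsub>F\<^esub> = cls []"
  by (simp add: free_product_def)

text \<open>Left inverses suffice for the group axioms, and words are inverted letter by letter.\<close>

lemma letter_inverse:
  assumes "x \<in> carrier G\<^sub>1 <+> carrier G\<^sub>2"
  shows "\<exists>y. [y] \<in> words \<and> ([y, x], []) \<in> rel"
proof (cases x)
  case (Inl a)
  then have a: "a \<in> carrier G\<^sub>1" using assms by auto
  have "([Inl (inv\<^bsub>G\<^sub>1\<^esub> a), Inl a], [Inl \<one>\<^bsub>G\<^sub>1\<^esub>]) \<in> rel"
    using free_product_rel.mult1 [of "[]" G\<^sub>1 G\<^sub>2 "[]" "inv\<^bsub>G\<^sub>1\<^esub> a" a] a by simp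
  moreover have "([Inl \<one>\<^bsub>G\<^sub>1\<^esub>], []) \<in> rel"
    using free_product_rel.one1 [of "[]" G\<^sub>1 G\<^sub>2 "[]"] by simp
  ultimately have "([Inl (inv\<^bsub>G\<^sub>1\<^esub> a), Inl a], []) \<in> rel"
    by (rule free_product_rel.trans)
  then show ?thesis
    using a Inl by (intro exI [of _ "Inl (inv\<^bsub>G\<^sub>1\<^esub> a)"]) simp
next
  case (Inr b)
  then have b: "b \<in> carrier G\<^sub>2" using assms by auto
  have "([Inr (inv\<^bsub>G\<^sub>2\<^esub> b), Inr b], [Inr \<one>\<^bsub>G\<^sub>2\<^esub>]) \<in> rel"
    using free_product_rel.mult2 [of "[]" G\<^sub>1 G\<^sub>2 "[]" "inv\<^bsub>G\<^sub>2\<^esub> b" b] b by simp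
  moreover have "([Inr \<one>\<^bsub>G\<^sub>2\<^esub>], []) \<in> rel"
    using free_product_rel.one2 [of "[]" G\<^sub>1 G\<^sub>2 "[]"] by simp
  ultimately have "([Inr (inv\<^bsub>G\<^sub>2\<^esub> b), Inr b], []) \<in> rel"
    by (rule free_product_rel.trans)
  then show ?thesis
    using b Inr by (intro exI [of _ "Inr (inv\<^bsub>G\<^sub>2\<^esub> b)"]) simp
qed

lemma word_inverse:
  assumes "u \<in> words"
  shows "\<exists>v. v \<in> words \<and> (v @ u, []) \<in> rel"
  using assms
proof (induction u)
  case Nil
  show ?case
    by (rule exI [of _ "[]"]) (auto intro: free_product_rel.refl)
next
  case (Cons x u)
  then have x: "x \<in> carrier G\<^sub>1 <+> carrier G\<^sub>2" and u: "u \<in> words"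
    by (auto simp: free_product_words_def)
  obtain y where y: "[y] \<in> words" "([y, x], []) \<in> rel"
    using letter_inverse [OF x] by blast
  obtain v where v: "v \<in> words" "(v @ u, []) \<in> rel"
    using Cons u by blast
  have "((v @ [y]) @ x # u, v @ u) \<in> rel"
    using rel_context [OF y(2) v(1) u] by simp
  then have "((v @ [y]) @ x # u, []) \<in> rel"
    using v(2) by (rule free_product_rel.trans)
  then show ?case
    using v(1) y(1) words_simps(2) by blast
qed

sublocale F: group F
proof (rule groupI)
  fix X assume "X \<in> carrier F"
  then obtain u where u: "u \<in> words" "X = cls u"
    by (auto simp: carrier_F)
  obtain v where v: "v \<in> words" "(v @ u, []) \<in> rel"
    using word_inverse [OF u(1)] by blast
  then have "cls v \<otimes>\<^bsub>F\<^esub> X = \<one>\<^bsub>F\<^esub>"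
    using u by (simp add: mult_F one_F cls_eq_iff)
  then show "\<exists>Y\<in>carrier F. Y \<otimes>\<^bsub>F\<^esub> X = \<one>\<^bsub>F\<^esub>"
    using v(1) by (auto simp: carrier_F)
next
  fix X Y assume "X \<in> carrier F" "Y \<in> carrier F"
  then obtain u v where "u \<in> words" "X = cls u" "v \<in> words" "Y = cls v"
    by (auto simp: carrier_F)
  then have "X \<otimes>\<^bsub>F\<^esub> Y = cls (u @ v)" "u @ v \<in> words"
    by (simp_all add: mult_F)
  then show "X \<otimes>\<^bsub>F\<^esub> Y \<in> carrier F"
    by (auto simp: carrier_F)
next
  have "[] \<in> words" by simp
  then show "\<one>\<^bsub>F\<^esub> \<in> carrier F"
    unfolding carrier_F one_F by blast
next
  fix X Y Z assume "X \<in> carrier F" "Y \<in> carrier F" "Z \<in> carrier F"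
  then obtain u v w where "u \<in> words" "X = cls u" "v \<in> words" "Y = cls v" "w \<in> words" "Z = cls w"
    by (auto simp: carrier_F)
  then show "X \<otimes>\<^bsub>F\<^esub> Y \<otimes>\<^bsub>F\<^esub> Z = X \<otimes>\<^bsub>F\<^esub> (Y \<otimes>\<^bsub>F\<^esub> Z)"
    by (simp add: mult_F)
next
  fix X assume "X \<in> carrier F"
  then obtain u where "u \<in> words" "X = cls u"
    by (auto simp: carrier_F)
  then show "\<one>\<^bsub>F\<^esub> \<otimes>\<^bsub>F\<^esub> X = X"
    by (simp add: one_F mult_F)
qed

lemma inl_hom: "free_product_inl G\<^sub>1 G\<^sub>2 \<in> hom G\<^sub>1 F"
proof (rule homI)
  show "free_product_inl G\<^sub>1 G\<^sub>2 x \<in> carrier F" if "x \<in> carrier G\<^sub>1" for x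
    using that by (auto simp: free_product_inl_def carrier_F)
  show "free_product_inl G\<^sub>1 G\<^sub>2 (x \<otimes>\<^bsub>G\<^sub>1\<^esub> y) =
      free_product_inl G\<^sub>1 G\<^sub>2 x \<otimes>\<^bsub>F\<^esub> free_product_inl G\<^sub>1 G\<^sub>2 y"
    if "x \<in> carrier G\<^sub>1" "y \<in> carrier G\<^sub>1" for x y
  proof -
    have "([Inl x, Inl y], [Inl (x \<otimes>\<^bsub>G\<^sub>1\<^esub> y)]) \<in> rel"
      using that free_product_rel.mult1 [of "[]" G\<^sub>1 G\<^sub>2 "[]" x y] by simp
    then have "cls [Inl x, Inl y] = cls [Inl (x \<otimes>\<^bsub>G\<^sub>1\<^esub> y)]"
      by (rule equiv_class_eq [OF equiv_rel])
    then show ?thesis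
      using that by (simp add: free_product_inl_def mult_F)
  qed
qed

lemma inr_hom: "free_product_inr G\<^sub>1 G\<^sub>2 \<in> hom G\<^sub>2 F"
proof (rule homI)
  show "free_product_inr G\<^sub>1 G\<^sub>2 x \<in> carrier F" if "x \<in> carrier G\<^sub>2" for x
    using that by (auto simp: free_product_inr_def carrier_F)
  show "free_product_inr G\<^sub>1 G\<^sub>2 (x \<otimes>\<^bsub>G\<^sub>2\<^esub> y) =
      free_product_inr G\<^sub>1 G\<^sub>2 x \<otimes>\<^bsub>F\<^esub> free_product_inr G\<^sub>1 G\<^sub>2 y"
    if "x \<in> carrier G\<^sub>2" "y \<in> carrier G\<^sub>2" for x y
  proof -
    have "([Inr x, Inr y], [Inr (x \<otimes>\<^bsub>G\<^sub>2\<^esub> y)]) \<in> rel"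
      using that free_product_rel.mult2 [of "[]" G\<^sub>1 G\<^sub>2 "[]" x y] by simp
    then have "cls [Inr x, Inr y] = cls [Inr (x \<otimes>\<^bsub>G\<^sub>2\<^esub> y)]"
      by (rule equiv_class_eq [OF equiv_rel])
    then show ?thesis
      using that by (simp add: free_product_inr_def mult_F)
  qed
qed

abbreviation factors where
  "factors \<equiv> free_product_inl G\<^sub>1 G\<^sub>2 ` carrier G\<^sub>1 \<union> free_product_inr G\<^sub>1 G\<^sub>2 ` carrier G\<^sub>2"

lemma factors_subset: "factors \<subseteq> carrier F"
  using hom_in_carrier [OF inl_hom] hom_in_carrier [OF inr_hom] by blast

lemma generate_factors: "generate F factors = carrier F"
proof
  show "generate F factors \<subseteq> carrier F"
    using factors_subset by (rule F.generate_incl)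
  have "cls u \<in> generate F factors" if "u \<in> words" for u
    using that
  proof (induction u)
    case Nil
    then show ?case
      using generate.one [of F factors] by (simp only: one_F)
  next
    case (Cons x u)
    then have x: "[x] \<in> words" and u: "u \<in> words"
      by (auto simp: free_product_words_def)
    have "cls [x] \<in> factors"
      using x by (cases x) (auto simp: free_product_inl_def free_product_inr_def)
    then have "cls [x] \<otimes>\<^bsub>F\<^esub> cls u \<in> generate F factors"
      by (rule generate.eng [OF generate.incl Cons.IH [OF u]])
    then show ?case
      using mult_F [OF x u] by simp
  qed
  then show "carrier F \<subseteq> generate F factors"
    by (auto simp: carrier_F)
qed

end

text \<open>If \<open>S\<close> were not contained in the carrier, the intersection would be over the empty family.\<close>

lemma (in group) normal_hull:
  assumes "S \<subseteq> carrier G"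
  shows "(\<lambda>N. N \<lhd> G) hull S \<lhd> G"
proof -
  have "carrier G \<lhd> G"
    by (auto simp: normal_inv_iff subgroup_self)
  then have ne: "carrier G \<in> {N. N \<lhd> G \<and> S \<subseteq> N}"
    using assms by simp
  have "subgroup (\<Inter>{N. N \<lhd> G \<and> S \<subseteq> N}) G"
    using ne by (intro subgroups_Inter) (auto dest: normal_imp_subgroup)
  then show ?thesis
    unfolding hull_def normal_inv_iff [of "\<Inter>_"] by (auto simp: normal.inv_op_closed2)
qed

lemma amalgamated_product_generated:
  fixes G\<^sub>1 :: "('a, 'm) monoid_scheme" and G\<^sub>2 :: "('b, 'n) monoid_scheme"
  assumes "group G\<^sub>1" "group G\<^sub>2" and f: "f\<^sub>1 \<in> hom H G\<^sub>1" "f\<^sub>2 \<in> hom H G\<^sub>2"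
  defines "Q \<equiv> amalgamated_product H G\<^sub>1 G\<^sub>2 f\<^sub>1 f\<^sub>2"
  obtains i j where "group Q" "group_hom G\<^sub>1 Q i" "group_hom G\<^sub>2 Q j"
    "generate Q (i ` carrier G\<^sub>1 \<union> j ` carrier G\<^sub>2) = carrier Q"
proof -
  interpret two_groups G\<^sub>1 G\<^sub>2
    using assms(1,2) by (rule two_groups.intro)
  define S where "S = {free_product_inl G\<^sub>1 G\<^sub>2 (f\<^sub>1 h) \<otimes>\<^bsub>F\<^esub>
    inv\<^bsub>F\<^esub> (free_product_inr G\<^sub>1 G\<^sub>2 (f\<^sub>2 h)) | h. h \<in> carrier H}"
  define N where "N = (\<lambda>N. N \<lhd> F) hull S"
  have Q: "Q = F Mod N"
    by (simp add: Q_def amalgamated_product_def N_def S_def)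
  have S: "S \<subseteq> carrier F"
    unfolding S_def
    using hom_in_carrier [OF inl_hom] hom_in_carrier [OF inr_hom]
      hom_in_carrier [OF f(1)] hom_in_carrier [OF f(2)] by blast
  interpret N: normal N F
    unfolding N_def using S by (rule F.normal_hull)
  interpret Q: group Q
    unfolding Q by (rule N.factorgroup_is_group)
  interpret \<pi>: group_hom F Q "(#>\<^bsub>F\<^esub>) N"
    using N.r_coset_hom_Mod by unfold_locales (simp add: Q)
  show thesis
  proof (rule that)
    show "group Q" ..
    show "group_hom G\<^sub>1 Q ((#>\<^bsub>F\<^esub>) N \<circ> free_product_inl G\<^sub>1 G\<^sub>2)"
      using hom_compose [OF inl_hom \<pi>.homh] by unfold_locales
    show "group_hom G\<^sub>2 Q ((#>\<^bsub>F\<^esub>) N \<circ> free_product_inr G\<^sub>1 G\<^sub>2)"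
      using hom_compose [OF inr_hom \<pi>.homh] by unfold_locales
    show "generate Q (((#>\<^bsub>F\<^esub>) N \<circ> free_product_inl G\<^sub>1 G\<^sub>2) ` carrier G\<^sub>1 \<union>
        ((#>\<^bsub>F\<^esub>) N \<circ> free_product_inr G\<^sub>1 G\<^sub>2) ` carrier G\<^sub>2) = carrier Q"
      using \<pi>.generate_img [OF factors_subset]
      by (simp add: generate_factors image_Un image_comp Q carrier_FactGroup)
  qed
qed

section \<open>The trace space of an amalgamated product of finite groups\<close>

theorem theorem1p4:
  fixes H :: "('h, 'k) monoid_scheme"
    and G\<^sub>1 :: "('a, 'm) monoid_scheme"
    and G\<^sub>2 :: "('b, 'n) monoid_scheme"
    and f\<^sub>1 :: "'h \<Rightarrow> 'a"
    and f\<^sub>2 :: "'h \<Rightarrow> 'b"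
  assumes "group G\<^sub>1" and "finite (carrier G\<^sub>1)" and "carrier G\<^sub>1 \<noteq> {\<one>\<^bsub>G\<^sub>1\<^esub>}"
    and "group G\<^sub>2" and "finite (carrier G\<^sub>2)" and "carrier G\<^sub>2 \<noteq> {\<one>\<^bsub>G\<^sub>2\<^esub>}"
    and "group H" and "f\<^sub>1 \<in> hom H G\<^sub>1" and "f\<^sub>2 \<in> hom H G\<^sub>2"
  shows "\<not> poulsen_simplex (trace_space (amalgamated_product H G\<^sub>1 G\<^sub>2 f\<^sub>1 f\<^sub>2))"
proof -
  obtain i j where Q: "group (amalgamated_product H G\<^sub>1 G\<^sub>2 f\<^sub>1 f\<^sub>2)"
    and i: "group_hom G\<^sub>1 (amalgamated_product H G\<^sub>1 G\<^sub>2 f\<^sub>1 f\<^sub>2) i"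
    and j: "group_hom G\<^sub>2 (amalgamated_product H G\<^sub>1 G\<^sub>2 f\<^sub>1 f\<^sub>2) j"
    and gen: "generate (amalgamated_product H G\<^sub>1 G\<^sub>2 f\<^sub>1 f\<^sub>2) (i ` carrier G\<^sub>1 \<union> j ` carrier G\<^sub>2) =
      carrier (amalgamated_product H G\<^sub>1 G\<^sub>2 f\<^sub>1 f\<^sub>2)"
    using amalgamated_product_generated [OF assms(1,4,8,9)] by blast
  show ?thesis
    by (rule group.trace_space_not_poulsen [OF Q group_hom.img_is_subgroup [OF i] _
          group_hom.img_is_subgroup [OF j] _ gen])
      (simp_all add: assms(2,5))
qed

end
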